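(* Let $(X,d,\mu)$ be a measured metric space such that $(X,d)$ is $\delta$-hyperbolic, let $\sigma\ge 1$, and suppose $(X,d,\mu)$ satisfies the local Poincaré inequality $P_{loc}$ with exponent $\sigma$ for some $r_0\ge 1$. Let $\Gamma$ be a group acting on $X$ isometrically and properly such that the diameter of the quotient space $\Gamma\backslash X$ is bounded by $D$. Suppose that the action of $\Gamma$ preserves $\mu$ and that the entropy of $(X,d,\mu)$ is bounded above by $H$. Then there exist $C_0=C_0(\delta,D,H,\mu,\sigma)>0$ and $\lambda\ge 1$ such that for every $u\in C(X)$ and every upper gradient $g_u$ of $u$, $$\int_{B(x,R)}|u-u_R|^{\sigma}\,d\mu\le C_0\,R^{\sigma+6HD+\frac{21}{4}}e^{12\lambda HR}\int_{B(x,2\lambda R)}g_u^{\sigma}\,d\mu\qquad\forall R\ge\tfrac52(7D+4\delta),\ \forall x\in X.$$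
   Context: A measured metric space $(X,d,\mu)$ is a proper geodesic metric space $(X,d)$ (all closed balls are compact and any two points can be joined by a geodesic) together with a Borel measure $\mu$ on $X$ such that every closed ball has finite positive measure. $B(x,R)$ is the open ball of radius $R$ about $x$. $C(X)$ is the space of continuous real functions on $X$. An upper gradient of $u\in C(X)$ is a Borel function $g_u:X\to[0,\infty]$ such that for each curve $\gamma:[0,1]\to X$ of finite length $l(\gamma)$ and constant speed, $|u(\gamma(1))-u(\gamma(0))|\le l(\gamma)\int_0^1 g_u(\gamma(t))\,dt$. $u_R(x)=\frac{1}{\mu(B(x,R))}\int_{B(x,R)}u\,d\mu$; inside an integral over $B(x,R)$, $u_R$ denotes the constant $u_R(x)$. $P_{loc}$ with exponent $\sigma$ for $r_0>0$: there is a constant $C>0$ such that for every $u\in C(X)$ and every upper gradient $g_u$ of $u$, $\int_{B(x,R)}|u-u_R|^{\sigma}d\mu\le C\int_{B(x,R)}g_u^{\sigma}d\mu$ for all $x\in X$ and $0<R\le r_0$. A geodesic triangle is $\delta$-thin if any point on one of its sides lies in the $\delta$-neighbourhood of the union of the other two sides; a proper geodesic metric space is $\delta$-hyperbolic ($\delta\ge 0$) if all its geodesic triangles are $\delta$-thin. The entropy is ${\rm Ent}(X,d,\mu)=\liminf_{R\to\infty}\frac1R\ln(\mu(B(x,R)))$, which is independent of $x$. The diameter of $\Gamma\backslash X$ is with respect to the quotient distance $\bar d(\Gamma x,\Gamma y)=\inf_{\gamma\in\Gamma}d(x,\gamma y)$. *)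

theory Defs
  imports "HOL-Analysis.Analysis" "HOL-Algebra.Group_Action"
begin

section \<open>Geodesic and hyperbolic metric spaces\<close>

definition geodesic_path :: "(real \<Rightarrow> 'a::metric_space) \<Rightarrow> real \<Rightarrow> 'a \<Rightarrow> 'a \<Rightarrow> bool" where
  "geodesic_path c L x y \<longleftrightarrow>
     0 \<le> L \<and> c 0 = x \<and> c L = y \<and> (\<forall>s\<in>{0..L}. \<forall>t\<in>{0..L}. dist (c s) (c t) = \<bar>s - t\<bar>)"

definition geodesic_segment :: "'a::metric_space set \<Rightarrow> 'a \<Rightarrow> 'a \<Rightarrow> bool" where
  "geodesic_segment S x y \<longleftrightarrow> (\<exists>c L. geodesic_path c L x y \<and> S = c ` {0..L})"

definition proper_geodesic_space :: "'a::metric_space itself \<Rightarrow> bool" where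
  "proper_geodesic_space _ \<longleftrightarrow>
     (\<forall>(x::'a) r. compact (cball x r)) \<and>
     (\<forall>x y::'a. \<exists>S. geodesic_segment S x y)"

text \<open>Neighbourhoods are closed ones, so that \<open>\<delta> = 0\<close> is meaningful (trees).\<close>

definition thin_triangle :: "real \<Rightarrow> 'a::metric_space set \<Rightarrow> 'a set \<Rightarrow> 'a set \<Rightarrow> bool" where
  "thin_triangle \<delta> S1 S2 S3 \<longleftrightarrow>
     (\<forall>p\<in>S1. \<exists>q\<in>S2 \<union> S3. dist p q \<le> \<delta>) \<and>
     (\<forall>p\<in>S2. \<exists>q\<in>S1 \<union> S3. dist p q \<le> \<delta>) \<and>
     (\<forall>p\<in>S3. \<exists>q\<in>S1 \<union> S2. dist p q \<le> \<delta>)"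

definition gromov_hyperbolic_space :: "'a::metric_space itself \<Rightarrow> real \<Rightarrow> bool" where
  "gromov_hyperbolic_space T \<delta> \<longleftrightarrow>
     proper_geodesic_space T \<and> 0 \<le> \<delta> \<and>
     (\<forall>(x::'a) y z S1 S2 S3.
        geodesic_segment S1 x y \<longrightarrow> geodesic_segment S2 y z \<longrightarrow> geodesic_segment S3 z x \<longrightarrow>
        thin_triangle \<delta> S1 S2 S3)"

section \<open>Measured metric spaces and entropy\<close>

definition measured_metric_space :: "'a::metric_space measure \<Rightarrow> bool" where
  "measured_metric_space \<mu> \<longleftrightarrow>
     proper_geodesic_space TYPE('a) \<and>
     sets \<mu> = sets borel \<and>
     (\<forall>x r. 0 < r \<longrightarrow> 0 < emeasure \<mu> (cball x r) \<and> emeasure \<mu> (cball x r) < \<infinity>)"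

text \<open>The value does not depend on the base point \<open>x\<close>, because
  \<open>ball x R \<subseteq> ball y (R + dist x y)\<close>.\<close>

definition volume_entropy :: "'a::metric_space measure \<Rightarrow> 'a \<Rightarrow> ereal" where
  "volume_entropy \<mu> x = Liminf at_top (\<lambda>R::real. ereal (1 / R * ln (measure \<mu> (ball x R))))"

section \<open>Upper gradients and the local Poincare inequality\<close>

text \<open>The length of \<open>\<gamma>\<close> restricted to \<open>{a..b}\<close>, as a supremum over increasing tuples of points.\<close>

definition curve_length :: "(real \<Rightarrow> 'a::metric_space) \<Rightarrow> real \<Rightarrow> real \<Rightarrow> ennreal" where
  "curve_length \<gamma> a b =
     (SUP ts \<in> {ts. sorted ts \<and> set ts \<subseteq> {a..b}}.
        \<Sum>i<length ts - 1. ennreal (dist (\<gamma> (ts ! i)) (\<gamma> (ts ! Suc i))))"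

definition constant_speed_curve :: "(real \<Rightarrow> 'a::metric_space) \<Rightarrow> bool" where
  "constant_speed_curve \<gamma> \<longleftrightarrow>
     path \<gamma> \<and> curve_length \<gamma> 0 1 < \<infinity> \<and>
     (\<forall>s t. 0 \<le> s \<longrightarrow> s \<le> t \<longrightarrow> t \<le> 1 \<longrightarrow>
        curve_length \<gamma> s t = ennreal (t - s) * curve_length \<gamma> 0 1)"

definition upper_gradient :: "('a::metric_space \<Rightarrow> real) \<Rightarrow> ('a \<Rightarrow> ennreal) \<Rightarrow> bool" where
  "upper_gradient u g \<longleftrightarrow>
     g \<in> borel_measurable borel \<and>
     (\<forall>\<gamma>. constant_speed_curve \<gamma> \<longrightarrow>
        ennreal \<bar>u (\<gamma> 1) - u (\<gamma> 0)\<bar> \<le>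
          curve_length \<gamma> 0 1 * (\<integral>\<^sup>+t\<in>{0..1}. g (\<gamma> t) \<partial>lborel))"

definition ball_mean :: "'a::metric_space measure \<Rightarrow> ('a \<Rightarrow> real) \<Rightarrow> 'a \<Rightarrow> real \<Rightarrow> real" where
  "ball_mean \<mu> u x R = 1 / measure \<mu> (ball x R) * (LINT y:ball x R|\<mu>. u y)"

text \<open>Used for exponents \<open>a > 0\<close> only, where \<open>\<infinity>\<close> has to be raised to \<open>\<infinity>\<close>.\<close>

definition ennreal_powr :: "ennreal \<Rightarrow> real \<Rightarrow> ennreal" where
  "ennreal_powr t a = (if t = \<infinity> then \<infinity> else ennreal (enn2real t powr a))"

definition oscillation_integral ::
  "'a::metric_space measure \<Rightarrow> real \<Rightarrow> ('a \<Rightarrow> real) \<Rightarrow> 'a \<Rightarrow> real \<Rightarrow> ennreal" where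
  "oscillation_integral \<mu> \<sigma> u x R =
     (\<integral>\<^sup>+y\<in>ball x R. ennreal (\<bar>u y - ball_mean \<mu> u x R\<bar> powr \<sigma>) \<partial>\<mu>)"

definition gradient_integral ::
  "'a::metric_space measure \<Rightarrow> real \<Rightarrow> ('a \<Rightarrow> ennreal) \<Rightarrow> 'a \<Rightarrow> real \<Rightarrow> ennreal" where
  "gradient_integral \<mu> \<sigma> g x R = (\<integral>\<^sup>+y\<in>ball x R. ennreal_powr (g y) \<sigma> \<partial>\<mu>)"

definition local_poincare :: "'a::metric_space measure \<Rightarrow> real \<Rightarrow> real \<Rightarrow> bool" where
  "local_poincare \<mu> \<sigma> r0 \<longleftrightarrow>
     (\<exists>C>0. \<forall>u g. continuous_on UNIV u \<longrightarrow> upper_gradient u g \<longrightarrow>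
        (\<forall>x R. 0 < R \<longrightarrow> R \<le> r0 \<longrightarrow>
           oscillation_integral \<mu> \<sigma> u x R \<le> ennreal C * gradient_integral \<mu> \<sigma> g x R))"

section \<open>Group actions\<close>

definition isometric_action ::
  "('g, 'b) monoid_scheme \<Rightarrow> ('g \<Rightarrow> 'a::metric_space \<Rightarrow> 'a) \<Rightarrow> bool" where
  "isometric_action G \<phi> \<longleftrightarrow>
     group_action G UNIV \<phi> \<and>
     (\<forall>g\<in>carrier G. \<forall>x y. dist (\<phi> g x) (\<phi> g y) = dist x y)"

text \<open>Proper action of a discrete group.\<close>

definition proper_action ::
  "('g, 'b) monoid_scheme \<Rightarrow> ('g \<Rightarrow> 'a::metric_space \<Rightarrow> 'a) \<Rightarrow> bool" where
  "proper_action G \<phi> \<longleftrightarrow>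
     (\<forall>K. compact K \<longrightarrow> finite {g \<in> carrier G. \<phi> g ` K \<inter> K \<noteq> {}})"

definition measure_preserving_action ::
  "('g, 'b) monoid_scheme \<Rightarrow> ('g \<Rightarrow> 'a::metric_space \<Rightarrow> 'a) \<Rightarrow> 'a measure \<Rightarrow> bool" where
  "measure_preserving_action G \<phi> \<mu> \<longleftrightarrow> (\<forall>g\<in>carrier G. distr \<mu> \<mu> (\<phi> g) = \<mu>)"

text \<open>The distance between the orbits of \<open>x\<close> and \<open>y\<close>.\<close>

definition quotient_dist ::
  "('g, 'b) monoid_scheme \<Rightarrow> ('g \<Rightarrow> 'a::metric_space \<Rightarrow> 'a) \<Rightarrow> 'a \<Rightarrow> 'a \<Rightarrow> real" where
  "quotient_dist G \<phi> x y = (INF g\<in>carrier G. dist x (\<phi> g y))"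

definition quotient_diameter ::
  "('g, 'b) monoid_scheme \<Rightarrow> ('g \<Rightarrow> 'a::metric_space \<Rightarrow> 'a) \<Rightarrow> ereal" where
  "quotient_diameter G \<phi> = (SUP x. SUP y. ereal (quotient_dist G \<phi> x y))"

end

(*
  Chaining the local inequality along balls of radius 1/2 from x to the members of a cover of B(x,R)
  by N(R) balls of radius 1/2, and bounding every link by the whole gradient integral, gives
  int_B(x,R) |u - u_R|^sigma <= K N(R) R^sigma int_B(x,R+2) g^sigma, so only N(R) matters.

  If H > 0, cocompactness gives N(R) <= C exp(kappa R), and kappa <= 12 Lambda H for Lambda large.

  If H = 0, exponential volume growth is excluded. A tripod with arms much longer than delta and D
  could be translated next to every point and would produce a binary tree of disjoint balls, so there
  is none. As every geodesic triangle has a centre, each three points are then nearly aligned, annuli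
  of width 1 are covered by two balls of fixed radius, and N(R) is linear in R.

  The threshold for R is positive unless D = delta = 0, and then X is a single point.
*)
theory Submission
  imports Defs
begin

section \<open>Triangles in hyperbolic spaces\<close>

text \<open>Both \<open>C0\<close> and \<open>\<Lambda>\<close> may depend on the space, so covering
  numbers can be bounded crudely: whatever exponential rate a compactness argument yields is
  absorbed by \<open>\<Lambda>\<close>. The obstacle is H = 0, where the exponential factor is 1 for
  every \<open>\<Lambda>\<close> and only a power of R is left. The exponent beyond \<sigma> is then
  21/4, which has room for the linear count that hyperbolicity provides. The action enters the
  estimates as the property that a measure preserving isometry moves any point to within E = D + 1
  of any other, so that bounds on one compact ball hold around every point. The positive threshold
  turns additive errors such as R + 2 into multiples of R, and lower powers of R into higher
  ones.\<close>

definition gromov_product :: "'a::metric_space \<Rightarrow> 'a \<Rightarrow> 'a \<Rightarrow> real" where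
  "gromov_product p x y = (dist p x + dist p y - dist x y) / 2"

lemma gromov_product_commute: "gromov_product p x y = gromov_product p y x"
  by (simp add: gromov_product_def dist_commute)

lemma gromov_product_le_dist: "gromov_product p x y \<le> dist p x"
  using dist_triangle2[of p y x] by (simp add: gromov_product_def dist_commute)

lemma gromov_product_change_base: "gromov_product q x y \<le> gromov_product p x y + dist p q"
  using dist_triangle[of q x p] dist_triangle[of q y p]
  by (simp add: gromov_product_def dist_commute field_simps)

lemma gromov_product_swap: "gromov_product x p y = dist p x - gromov_product p x y"
  by (simp add: gromov_product_def dist_commute field_simps)

lemma geodesic_path_imp_dist:
  assumes "geodesic_path c L x y"
  shows "dist x y = L"
proof -
  have "dist (c 0) (c L) = \<bar>0 - L\<bar>"
    using assms unfolding geodesic_path_def by (metis atLeastAtMost_iff order_refl)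
  then show ?thesis using assms by (simp add: geodesic_path_def)
qed

lemma geodesic_path_continuous:
  assumes "geodesic_path c L x y"
  shows "continuous_on {0..L} c"
  unfolding continuous_on_iff
proof (intro ballI allI impI)
  fix s and e :: real assume "s \<in> {0..L}" "0 < e"
  then show "\<exists>d>0. \<forall>t\<in>{0..L}. dist t s < d \<longrightarrow> dist (c t) (c s) < e"
    using assms by (intro exI[of _ e]) (simp add: geodesic_path_def dist_real_def)
qed

lemma geodesic_segmentD:
  assumes "geodesic_segment S x y"
  shows "compact S" "connected S" "x \<in> S" "y \<in> S"
    "\<And>q. q \<in> S \<Longrightarrow> dist x q + dist q y = dist x y"
proof -
  obtain c L where c: "geodesic_path c L x y" and S: "S = c ` {0..L}"
    using assms unfolding geodesic_segment_def by blast
  then have L: "0 \<le> L" "c 0 = x" "c L = y"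
    by (auto simp: geodesic_path_def)
  show "compact S" "connected S"
    unfolding S using geodesic_path_continuous[OF c]
    by (auto intro!: compact_continuous_image connected_continuous_image)
  show "x \<in> S" "y \<in> S"
    using L S by force+
  fix q assume "q \<in> S"
  then obtain t where t: "t \<in> {0..L}" "q = c t" using S by blast
  have "dist (c 0) (c t) = \<bar>0 - t\<bar>" "dist (c t) (c L) = \<bar>t - L\<bar>"
    using c t L(1) unfolding geodesic_path_def by auto
  then show "dist x q + dist q y = dist x y"
    using L t geodesic_path_imp_dist[OF c] by auto
qed

lemma gromov_product_le_dist_segment:
  assumes "geodesic_segment S x y" "q \<in> S"
  shows "gromov_product p x y \<le> dist p q"
proof -
  have "dist x q + dist q y = dist x y"
    using geodesic_segmentD[OF assms(1)] assms(2) by blast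
  then show ?thesis
    using dist_triangle[of p x q] dist_triangle[of p y q]
    by (simp add: gromov_product_def dist_commute)
qed

text \<open>In this form geodesics enter covers and chains: the ball of radius a + b lies in the
  b-neighbourhood of the ball of radius a. Inequalities are used because a may exceed
  \<open>dist x y\<close>.\<close>

lemma geodesic_intermediate_point:
  fixes x y :: "'a::metric_space"
  assumes "proper_geodesic_space TYPE('a)" "0 \<le> a" "0 \<le> b" "dist x y \<le> a + b"
  obtains z where "dist x z \<le> a" "dist z y \<le> b"
proof -
  obtain c L where c: "geodesic_path c L x y"
    using assms(1) unfolding proper_geodesic_space_def geodesic_segment_def by blast
  have L: "dist x y = L" "c 0 = x" "c L = y" "0 \<le> L"
    using c geodesic_path_imp_dist[OF c] by (auto simp: geodesic_path_def)
  have "min a L \<in> {0..L}" "0 \<in> {0..L}" "L \<in> {0..L}" using assms L by auto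
  then have "dist (c 0) (c (min a L)) = \<bar>0 - min a L\<bar>" "dist (c (min a L)) (c L) = \<bar>min a L - L\<bar>"
    using c unfolding geodesic_path_def by blast+
  then show thesis
    using that[of "c (min a L)"] L assms by (auto simp: min_def split: if_splits)
qed

text \<open>The side \<open>S1\<close> is connected and covered by the closed
  \<delta>-neighbourhoods of the other two sides. Each of these contains an endpoint of
  \<open>S1\<close>, so some point of \<open>S1\<close> lies in both.\<close>

lemma thin_triangle_center:
  fixes x y z :: "'a::metric_space"
  assumes "gromov_hyperbolic_space TYPE('a) \<delta>"
    and S1: "geodesic_segment S1 x y" and S2: "geodesic_segment S2 y z"
    and S3: "geodesic_segment S3 z x"
  obtains c q r where "c \<in> S1" "q \<in> S2" "r \<in> S3" "dist c q \<le> \<delta>" "dist c r \<le> \<delta>"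
proof -
  note D = geodesic_segmentD(1-4)[OF S1] geodesic_segmentD(1-4)[OF S2] geodesic_segmentD(1-4)[OF S3]
  have thin: "\<forall>p\<in>S1. \<exists>q\<in>S2 \<union> S3. dist p q \<le> \<delta>" and \<delta>: "0 \<le> \<delta>"
    using assms unfolding gromov_hyperbolic_space_def thin_triangle_def by blast+
  define N where "N = (\<lambda>S. {p. infdist p S \<le> \<delta>} :: 'a set)"
  have N: "closed (N S)" for S
    unfolding N_def by (intro closed_Collect_le continuous_intros)
  have N_iff: "p \<in> N S \<longleftrightarrow> (\<exists>q\<in>S. dist p q \<le> \<delta>)" if S: "compact S" "S \<noteq> {}" for p S
  proof
    obtain q where q: "q \<in> S" "\<forall>r\<in>S. dist p q \<le> dist p r"
      using continuous_attains_inf[OF S continuous_on_dist[OF continuous_on_const continuous_on_id], of p] by auto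
    then have "dist p q \<le> infdist p S"
      by (simp add: infdist_notempty[OF S(2)] cINF_greatest S(2))
    then show "\<exists>q\<in>S. dist p q \<le> \<delta>" if "p \<in> N S"
      using that q(1) by (intro bexI[of _ q]) (auto simp: N_def)
  qed (auto simp: N_def intro: infdist_le2)
  have N2: "p \<in> N S2 \<longleftrightarrow> (\<exists>q\<in>S2. dist p q \<le> \<delta>)"
    and N3: "p \<in> N S3 \<longleftrightarrow> (\<exists>q\<in>S3. dist p q \<le> \<delta>)" for p
    using D by (auto intro!: N_iff)
  have "S1 \<subseteq> N S2 \<union> N S3"
    using thin N2 N3 by blast
  moreover have "y \<in> N S2 \<inter> S1" "x \<in> N S3 \<inter> S1"
    using D \<delta> N2[of y] N3[of x] by (auto intro: bexI[of _ y] bexI[of _ x])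
  ultimately have "N S2 \<inter> N S3 \<inter> S1 \<noteq> {}"
    using D(2) N unfolding connected_closed by blast
  then show thesis using that N2 N3 by blast
qed

text \<open>A centre w of the triangle x, y, p has distance at most
  \<open>gromov_product p x y + 2 * \<delta>\<close> from p. Thinness of the triangle x, y, z puts w
  within \<delta> of a side through z, and the distance from p to a side is at least the Gromov
  product of its ends. The errors add up to 3 * \<delta>.\<close>

lemma gromov_product_four_point:
  fixes p x y z :: "'a::metric_space"
  assumes hyp: "gromov_hyperbolic_space TYPE('a) \<delta>"
  shows "min (gromov_product p x z) (gromov_product p z y) \<le> gromov_product p x y + 3 * \<delta>"
proof -
  have geo: "\<exists>S. geodesic_segment S a b" for a b :: 'a
    using hyp unfolding gromov_hyperbolic_space_def proper_geodesic_space_def by blast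
  obtain S T1 T2 U1 U2 where S: "geodesic_segment S x y"
    and T: "geodesic_segment T1 y p" "geodesic_segment T2 p x"
    and U: "geodesic_segment U1 y z" "geodesic_segment U2 z x"
    using geo by metis
  obtain w q r where w: "w \<in> S" "q \<in> T1" "r \<in> T2" "dist w q \<le> \<delta>" "dist w r \<le> \<delta>"
    using thin_triangle_center[OF hyp S T] by blast
  have "dist x w + dist w y = dist x y" "dist y q + dist q p = dist y p" "dist p r + dist r x = dist p x"
    using geodesic_segmentD(5) S T w by blast+
  then have A: "dist p w \<le> gromov_product p x y + 2 * \<delta>"
    using w dist_triangle[of p w q] dist_triangle[of w y q] dist_triangle[of p w r] dist_triangle[of w x r]
    by (simp add: gromov_product_def dist_commute field_simps)
  obtain v where v: "v \<in> U1 \<union> U2" "dist w v \<le> \<delta>"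
    using hyp S U w(1) unfolding gromov_hyperbolic_space_def thin_triangle_def by blast
  have "gromov_product p y z \<le> dist p v \<or> gromov_product p z x \<le> dist p v"
    using v gromov_product_le_dist_segment U by blast
  then show ?thesis
    using A v dist_triangle[of p v w] gromov_product_commute[of p y z] gromov_product_commute[of p x z]
    by linarith
qed

lemma triangle_center:
  fixes x y z :: "'a::metric_space"
  assumes hyp: "gromov_hyperbolic_space TYPE('a) \<delta>"
  obtains c where "gromov_product c x y \<le> \<delta>" "gromov_product c y z \<le> \<delta>" "gromov_product c x z \<le> \<delta>"
proof -
  have geo: "\<exists>S. geodesic_segment S a b" for a b :: 'a
    using hyp unfolding gromov_hyperbolic_space_def proper_geodesic_space_def by blast
  obtain S T1 T2 where S: "geodesic_segment S x y"
    and T: "geodesic_segment T1 y z" "geodesic_segment T2 z x"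
    using geo by metis
  obtain c q r where c: "c \<in> S" "q \<in> T1" "r \<in> T2" "dist c q \<le> \<delta>" "dist c r \<le> \<delta>"
    using thin_triangle_center[OF hyp S T] by blast
  have "0 \<le> \<delta>" using hyp by (simp add: gromov_hyperbolic_space_def)
  show thesis
  proof
    show "gromov_product c x y \<le> \<delta>"
      using gromov_product_le_dist_segment[OF S c(1), of c] \<open>0 \<le> \<delta>\<close> by simp
    show "gromov_product c y z \<le> \<delta>"
      using gromov_product_le_dist_segment[OF T(1) c(2), of c] c by simp
    show "gromov_product c x z \<le> \<delta>"
      using gromov_product_le_dist_segment[OF T(2) c(3), of c] c
      by (simp add: gromov_product_commute)
  qed
qed

section \<open>Tripods, near alignment and unit annuli\<close>

definition has_tripod :: "'a::metric_space itself \<Rightarrow> real \<Rightarrow> real \<Rightarrow> bool" where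
  "has_tripod _ k L \<longleftrightarrow> (\<exists>c (a::nat \<Rightarrow> 'a).
     (\<forall>i<3. L \<le> dist c (a i)) \<and>
     (\<forall>i<3. \<forall>j<3. i \<noteq> j \<longrightarrow> gromov_product c (a i) (a j) \<le> k))"

text \<open>The centre of the triangle would carry a tripod with arms of length L, so it is closer
  than L to some vertex. Moving the base point of the Gromov product from the centre to this vertex
  costs at most that distance.\<close>

lemma aligned_if_no_tripod:
  fixes x y z :: "'a::metric_space"
  assumes hyp: "gromov_hyperbolic_space TYPE('a) \<delta>" and no: "\<not> has_tripod TYPE('a) \<delta> L"
  shows "gromov_product x y z \<le> \<delta> + L \<or> gromov_product y x z \<le> \<delta> + L \<or> gromov_product z x y \<le> \<delta> + L"
proof -
  obtain c where c: "gromov_product c x y \<le> \<delta>" "gromov_product c y z \<le> \<delta>" "gromov_product c x z \<le> \<delta>"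
    using triangle_center[OF hyp] by blast
  have "\<not> (L \<le> dist c x \<and> L \<le> dist c y \<and> L \<le> dist c z)"
  proof
    assume L: "L \<le> dist c x \<and> L \<le> dist c y \<and> L \<le> dist c z"
    define a where "a = (\<lambda>i::nat. if i = 0 then x else if i = 1 then y else z)"
    have three: "i = 0 \<or> i = 1 \<or> i = 2" if "i < 3" for i :: nat using that by linarith
    have "\<forall>i<3. L \<le> dist c (a i)" using L by (auto simp: a_def)
    moreover have "\<forall>i<3. \<forall>j<3. i \<noteq> j \<longrightarrow> gromov_product c (a i) (a j) \<le> \<delta>"
      using c by (auto simp: a_def gromov_product_commute dest!: three)
    ultimately show False using no unfolding has_tripod_def by blast
  qed
  then show ?thesis
    using c gromov_product_change_base[of x y z c] gromov_product_change_base[of y x z c]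
      gromov_product_change_base[of z x y c] by linarith
qed

text \<open>The third point of a near-alignment of two points of the annulus with \<open>x\<close> has to be \<open>x\<close> itself,
  and \<open>x\<close> cannot lie between each two of three points far from it.\<close>

lemma annulus_three_points:
  fixes x :: "'a::metric_space"
  assumes aligned: "\<And>p q r::'a. gromov_product p q r \<le> k \<or> gromov_product q p r \<le> k \<or> gromov_product r p q \<le> k"
    and k: "0 \<le> k"
    and S: "S = 6 * k + 5"
    and y: "\<And>i. i < (3::nat) \<Longrightarrow> m \<le> dist x (y i) \<and> dist x (y i) < m + 1"
  shows "\<exists>i<3. \<exists>j<3. i \<noteq> j \<and> dist (y i) (y j) \<le> S"
proof (rule ccontr)
  assume "\<not> ?thesis"
  then have far: "S < dist (y i) (y j)" if "i < 3" "j < 3" "i \<noteq> j" for i j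
    using that by force
  have xij: "gromov_product x (y i) (y j) \<le> k" if "i < 3" "j < 3" "i \<noteq> j" for i j
    using aligned[of x "y i" "y j"] far[OF that] y[OF that(1)] y[OF that(2)] k S
    by (auto simp: gromov_product_def dist_commute field_simps)
  have no: "\<not> gromov_product (y i) (y j) (y l) \<le> k"
    if "i < 3" "j < 3" "l < 3" "i \<noteq> j" "i \<noteq> l" "j \<noteq> l" for i j l
  proof -
    \<comment> \<open>With S = 6 * k + 5 this yields m > 3 * k + 1. Pairs of the three points are at
      distance at least 2 * m - 2 * k and below 2 * m + 2, so the product at \<open>y i\<close> is
      at least m - 2 * k - 1 > k.\<close>
    have "S < 2 * m + 2"
      using far[OF that(1,2,4)] y[OF that(1)] y[OF that(2)] dist_triangle3[of "y i" "y j" x] by linarith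
    then show ?thesis
      using xij[OF that(1,2,4)] xij[OF that(1,3,5)] k S
        y[OF that(1)] y[OF that(2)] y[OF that(3)] dist_triangle3[of "y j" "y l" x]
      by (simp add: gromov_product_def dist_commute field_simps)
  qed
  show False
    using aligned[of "y 0" "y 1" "y 2"] no[of 0 1 2] no[of 1 0 2] no[of 2 0 1] by simp
qed

text \<open>If two points of the annulus are more than S apart, every further point is within S of
  one of them, since among three points some two are close. Otherwise any single point of the
  annulus serves as centre.\<close>

lemma annulus_cover:
  fixes x :: "'a::metric_space"
  assumes "\<And>p q r::'a. gromov_product p q r \<le> k \<or> gromov_product q p r \<le> k \<or> gromov_product r p q \<le> k"
    and "0 \<le> k"
  shows "\<exists>T. finite T \<and> card T \<le> 2 \<and>
    {y. m \<le> dist x y \<and> dist x y < m + 1} \<subseteq> (\<Union>c\<in>T. cball c (6 * k + 5))"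
proof -
  define A where "A = {y. m \<le> dist x y \<and> dist x y < m + 1}"
  define S where "S = 6 * k + 5"
  have three: "dist a b \<le> S \<or> dist a c \<le> S \<or> dist b c \<le> S" if "a \<in> A" "b \<in> A" "c \<in> A" for a b c
  proof -
    define y where "y = (\<lambda>i::nat. if i = 0 then a else if i = 1 then b else c)"
    have "\<exists>i<3. \<exists>j<3. i \<noteq> j \<and> dist (y i) (y j) \<le> S"
      using that by (intro annulus_three_points[OF assms S_def]) (auto simp: y_def A_def)
    then obtain i j where ij: "i < 3" "j < 3" "i \<noteq> j" "dist (y i) (y j) \<le> S" by blast
    have "i = 0 \<or> i = 1 \<or> i = 2" "j = 0 \<or> j = 1 \<or> j = 2" using ij by linarith+
    then show ?thesis using ij by (auto simp: y_def dist_commute)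
  qed
  show ?thesis
  proof (cases "\<exists>a\<in>A. \<exists>b\<in>A. S < dist a b")
    case True
    then obtain a b where "a \<in> A" "b \<in> A" "S < dist a b" by blast
    then have "A \<subseteq> (\<Union>c\<in>{a, b}. cball c S)" using three by force
    moreover have "card {a, b} \<le> 2" by (simp add: card_insert_if)
    ultimately show ?thesis unfolding A_def S_def by (intro exI[of _ "{a, b}"]) simp
  next
    case False
    show ?thesis
    proof (cases "A = {}")
      case True
      then show ?thesis unfolding A_def by (intro exI[of _ "{}"]) auto
    next
      case nonempty: False
      then obtain a where "a \<in> A" by blast
      then have "A \<subseteq> (\<Union>c\<in>{a}. cball c S)" using False by force
      then show ?thesis unfolding A_def S_def by (intro exI[of _ "{a}"]) simp
    qed
  qed
qed

section \<open>Covers and volume growth\<close>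

definition measured_isometry :: "'a::metric_space measure \<Rightarrow> ('a \<Rightarrow> 'a) \<Rightarrow> bool" where
  "measured_isometry \<mu> f \<longleftrightarrow> surj f \<and> (\<forall>p q. dist (f p) (f q) = dist p q) \<and> distr \<mu> \<mu> f = \<mu>"

text \<open>Covers, volume growth and the Poincare estimates use the action in this form, without
  reference to a group.\<close>

definition homogeneous_within :: "'a::metric_space measure \<Rightarrow> real \<Rightarrow> bool" where
  "homogeneous_within \<mu> E \<longleftrightarrow> (\<forall>x y. \<exists>f. measured_isometry \<mu> f \<and> dist (f x) y \<le> E)"

text \<open>The centres need not belong to \<open>A\<close>. Balls of radius 1/2 whose centres are
  at most 1/2 apart lie in one ball of radius 1, where the local inequality is available.\<close>

definition covered_by :: "'a::metric_space set \<Rightarrow> nat \<Rightarrow> bool" where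
  "covered_by A N \<longleftrightarrow> (\<exists>T. finite T \<and> card T \<le> N \<and> A \<subseteq> (\<Union>c\<in>T. ball c (1/2)))"

lemma covered_by_mono:
  assumes "covered_by A N" "B \<subseteq> A" "N \<le> M"
  shows "covered_by B M"
  using assms unfolding covered_by_def by (meson order_trans)

lemma covered_by_UN:
  assumes "finite I" "card I \<le> N" "\<And>i. i \<in> I \<Longrightarrow> covered_by (A i) M"
  shows "covered_by (\<Union>i\<in>I. A i) (N * M)"
proof -
  obtain T where T: "\<And>i. i \<in> I \<Longrightarrow> finite (T i) \<and> card (T i) \<le> M \<and> A i \<subseteq> (\<Union>c\<in>T i. ball c (1/2))"
    using assms(3) unfolding covered_by_def by metis
  have "card (\<Union>i\<in>I. T i) \<le> (\<Sum>i\<in>I. card (T i))"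
    by (rule card_UN_le[OF assms(1)])
  also have "\<dots> \<le> card I * M"
    using sum_bounded_above[of I "\<lambda>i. card (T i)" M] T by simp
  also have "\<dots> \<le> N * M"
    using assms(2) by simp
  finally have "card (\<Union>i\<in>I. T i) \<le> N * M" .
  moreover have "(\<Union>i\<in>I. A i) \<subseteq> (\<Union>c\<in>(\<Union>i\<in>I. T i). ball c (1/2))"
    using T by blast
  moreover have "finite (\<Union>i\<in>I. T i)"
    using T assms(1) by blast
  ultimately show ?thesis unfolding covered_by_def by blast
qed

locale homogeneous_measured_space =
  fixes \<mu> :: "'a::metric_space measure" and E :: real
  assumes measured: "measured_metric_space \<mu>"
    and homogeneous: "homogeneous_within \<mu> E"
    and E_pos: "0 < E"
begin

lemma proper_geodesic: "proper_geodesic_space TYPE('a)"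
  using measured by (simp add: measured_metric_space_def)

lemma sets_eq [measurable_cong]: "sets \<mu> = sets borel"
  using measured by (simp add: measured_metric_space_def)

lemma space_eq: "space \<mu> = UNIV"
  using sets_eq_imp_space_eq[OF sets_eq] by simp

lemma compact_cball: "compact (cball (x::'a) r)"
  using proper_geodesic by (simp add: proper_geodesic_space_def)

lemma emeasure_cball: "0 < r \<Longrightarrow> 0 < emeasure \<mu> (cball x r) \<and> emeasure \<mu> (cball x r) < \<infinity>"
  using measured by (simp add: measured_metric_space_def)

lemma emeasure_ball_pos: "0 < r \<Longrightarrow> 0 < emeasure \<mu> (ball x r)"
proof -
  assume "0 < r"
  then have "emeasure \<mu> (cball x (r/2)) \<le> emeasure \<mu> (ball x r)"
    by (intro emeasure_mono) (auto simp: sets_eq)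
  moreover have "0 < emeasure \<mu> (cball x (r/2))"
    using emeasure_cball[of "r/2" x] \<open>0 < r\<close> by simp
  ultimately show ?thesis by (rule less_le_trans[rotated])
qed

lemma emeasure_ball_finite: "emeasure \<mu> (ball x r) < \<infinity>"
proof (cases "0 < r")
  case True
  have "emeasure \<mu> (ball x r) \<le> emeasure \<mu> (cball x r)"
    by (intro emeasure_mono) (auto simp: sets_eq)
  then show ?thesis using emeasure_cball[OF True, of x] by (simp add: le_less_trans)
next
  case False
  then have "ball x r = {}" by simp
  then have "emeasure \<mu> (ball x r) = 0" by (simp only: emeasure_empty)
  then show ?thesis by simp
qed

section \<open>Bounds and covers uniform in the centre\<close>

lemma emeasure_ball_isometry:
  assumes "measured_isometry \<mu> f"
  shows "emeasure \<mu> (ball (f x) r) = emeasure \<mu> (ball x r)"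
proof -
  have iso: "dist (f p) (f q) = dist p q" and distr: "distr \<mu> \<mu> f = \<mu>" for p q
    using assms by (auto simp: measured_isometry_def)
  then have "continuous_on UNIV f"
    unfolding continuous_on_iff by auto
  then have "f \<in> borel_measurable borel"
    by (rule borel_measurable_continuous_onI)
  then have f: "f \<in> measurable \<mu> \<mu>"
    using sets_eq by (simp cong: measurable_cong_sets)
  have "emeasure \<mu> (ball (f x) r) = emeasure (distr \<mu> \<mu> f) (ball (f x) r)"
    using distr by simp
  also have "\<dots> = emeasure \<mu> (f -` ball (f x) r \<inter> space \<mu>)"
    by (rule emeasure_distr[OF f]) (simp add: sets_eq)
  also have "f -` ball (f x) r \<inter> space \<mu> = ball x r"
    using iso by (auto simp: space_eq)
  finally show ?thesis .
qed

text \<open>As \<open>f\<close> is onto and \<open>f x\<close> is near p, the preimage of p is near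
  x. Hence every ball is the image of a ball centred in the compact set
  \<open>cball x E\<close>.\<close>

lemma move_near:
  obtains f q where "measured_isometry \<mu> f" "p = f q" "dist x q \<le> E"
proof -
  obtain f where f: "measured_isometry \<mu> f" "dist (f x) p \<le> E"
    using homogeneous unfolding homogeneous_within_def by blast
  then obtain q where "p = f q" unfolding measured_isometry_def by (metis surjD)
  then show thesis using that f unfolding measured_isometry_def by metis
qed

text \<open>Finitely many balls of radius r/2 cover \<open>cball x E\<close>. Any ball of radius r
  centred there contains one of them, so the least of their measures is a lower bound, and
  isometries carry it everywhere.\<close>

lemma ball_measure_lower_bound:
  assumes "0 < r"
  shows "\<exists>v>0. \<forall>p. ennreal v \<le> emeasure \<mu> (ball p r)"
proof -
  define x :: 'a where "x = undefined"
  obtain T where T: "finite T" "cball x E \<subseteq> (\<Union>c\<in>T. ball c (r/2))"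
    using compact_cball[of x E] assms unfolding compact_eq_totally_bounded by (meson half_gt_zero)
  have "x \<in> cball x E" using E_pos by simp
  then have "T \<noteq> {}" using T by auto
  define v where "v = Min ((\<lambda>c. measure \<mu> (ball c (r/2))) ` T)"
  have "0 < measure \<mu> (ball c (r/2))" for c
    using emeasure_ball_pos[of "r/2" c] emeasure_ball_finite[of c "r/2"] assms
    by (simp add: measure_def enn2real_positive_iff)
  then have "0 < v" unfolding v_def using T \<open>T \<noteq> {}\<close> by simp
  moreover have "ennreal v \<le> emeasure \<mu> (ball p r)" for p
  proof -
    obtain f q where f: "measured_isometry \<mu> f" and q: "p = f q" "dist x q \<le> E"
      using move_near by blast
    then obtain c where c: "c \<in> T" "dist c q < r/2"
      using T by force
    have "v \<le> measure \<mu> (ball c (r/2))" unfolding v_def using T c by simp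
    then have "ennreal v \<le> emeasure \<mu> (ball c (r/2))"
      using emeasure_ball_finite[of c "r/2"] by (simp add: emeasure_eq_ennreal_measure ennreal_leI)
    also have "\<dots> \<le> emeasure \<mu> (ball q r)"
    proof (rule emeasure_mono)
      show "ball c (r/2) \<subseteq> ball q r"
      proof
        fix y assume "y \<in> ball c (r/2)"
        then show "y \<in> ball q r"
          using c dist_triangle[of q y c] by (simp add: dist_commute)
      qed
    qed (simp add: sets_eq)
    also have "\<dots> = emeasure \<mu> (ball p r)"
      unfolding q(1) using emeasure_ball_isometry[OF f] by simp
    finally show ?thesis .
  qed
  ultimately show ?thesis by blast
qed

lemma ball_measure_upper_bound: "\<exists>V>0. \<forall>p. emeasure \<mu> (ball p r) \<le> ennreal V"
proof -
  define x :: 'a where "x = undefined"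
  define V where "V = measure \<mu> (ball x (E + r)) + 1"
  have "emeasure \<mu> (ball p r) \<le> ennreal V" for p
  proof -
    obtain f q where f: "measured_isometry \<mu> f" and q: "p = f q" "dist x q \<le> E"
      using move_near by blast
    have "emeasure \<mu> (ball p r) = emeasure \<mu> (ball q r)"
      unfolding q(1) using emeasure_ball_isometry[OF f] by simp
    also have "\<dots> \<le> emeasure \<mu> (ball x (E + r))"
    proof (rule emeasure_mono)
      show "ball q r \<subseteq> ball x (E + r)"
      proof
        fix y assume "y \<in> ball q r"
        then show "y \<in> ball x (E + r)"
          using q dist_triangle[of x y q] by simp
      qed
    qed (simp add: sets_eq)
    also have "\<dots> \<le> ennreal V"
      using emeasure_ball_finite[of x "E + r"]
      by (simp add: V_def emeasure_eq_ennreal_measure ennreal_leI)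
    finally show ?thesis .
  qed
  moreover have "0 < V" by (simp add: V_def add_nonneg_pos)
  ultimately show ?thesis by blast
qed

lemma cball_cover: "\<exists>M. \<forall>p::'a. covered_by (cball p r) M"
proof -
  define x :: 'a where "x = undefined"
  obtain T where T: "finite T" "cball x (E + r) \<subseteq> (\<Union>c\<in>T. ball c (1/2))"
    using compact_cball[of x "E + r"] unfolding compact_eq_totally_bounded by (meson half_gt_zero zero_less_one)
  have "covered_by (cball p r) (card T)" for p :: 'a
  proof -
    obtain f q where f: "measured_isometry \<mu> f" and q: "p = f q" "dist x q \<le> E"
      using move_near by blast
    have "cball p r \<subseteq> (\<Union>c\<in>f ` T. ball c (1/2))"
    proof
      fix y assume y: "y \<in> cball p r"
      obtain z where z: "y = f z" using f unfolding measured_isometry_def by (metis surjD)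
      then have "dist q z \<le> r" using y f q by (simp add: measured_isometry_def)
      then have "z \<in> cball x (E + r)" using q dist_triangle[of x z q] by simp
      then obtain c where "c \<in> T" "z \<in> ball c (1/2)" using T by blast
      then show "y \<in> (\<Union>c\<in>f ` T. ball c (1/2))" using z f by (auto simp: measured_isometry_def)
    qed
    then show ?thesis
      unfolding covered_by_def using T(1) card_image_le by blast
  qed
  then show ?thesis by blast
qed

text \<open>A ball enlarged by 1/4 is covered by the concentric balls of radius 1 around the old
  centres, because 1/2 + 1/4 < 1. Covering each of these anew multiplies the count by a fixed
  factor.\<close>

lemma exponential_cover: "\<exists>M\<ge>1. \<forall>(x::'a) k. covered_by (cball x (real k / 4)) (M ^ Suc k)"
proof -
  obtain M where M: "\<And>p::'a. covered_by (cball p 1) M"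
    using cball_cover by blast
  have "covered_by (cball x (real k / 4)) (max M 1 ^ Suc k)" for x :: 'a and k
  proof (induction k)
    case 0
    show ?case by (rule covered_by_mono[OF M[of x]]) auto
  next
    case (Suc k)
    then obtain T where T: "finite T" "card T \<le> max M 1 ^ Suc k"
      "cball x (real k / 4) \<subseteq> (\<Union>c\<in>T. ball c (1/2))"
      unfolding covered_by_def by blast
    have "covered_by (\<Union>c\<in>T. cball c 1) (max M 1 ^ Suc k * max M 1)"
      using T by (intro covered_by_UN covered_by_mono[OF M]) auto
    moreover have "cball x (real (Suc k) / 4) \<subseteq> (\<Union>c\<in>T. cball c 1)"
    proof
      fix y assume "y \<in> cball x (real (Suc k) / 4)"
      then have "dist x y \<le> real k / 4 + 1 / 4" by (simp add: field_simps)
      then obtain z where z: "dist x z \<le> real k / 4" "dist z y \<le> 1 / 4"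
        using geodesic_intermediate_point[OF proper_geodesic, of "real k / 4" "1 / 4" x y] by auto
      then have "z \<in> cball x (real k / 4)" by simp
      then obtain c where "c \<in> T" "z \<in> ball c (1/2)" using T by blast
      then show "y \<in> (\<Union>c\<in>T. cball c 1)"
        using z dist_triangle[of c y z] by (auto intro!: bexI[of _ c])
    qed
    ultimately show ?case
      by (rule covered_by_mono) (simp add: mult.commute)
  qed
  then show ?thesis by (intro exI[of _ "max M 1"]) simp
qed

lemma linear_cover:
  assumes "\<And>p q r::'a. gromov_product p q r \<le> k \<or> gromov_product q p r \<le> k \<or> gromov_product r p q \<le> k"
    and "0 \<le> k"
  shows "\<exists>M\<ge>1. \<forall>(x::'a) n. covered_by (cball x (real n)) (M * Suc n)"
proof -
  obtain M where M: "\<And>p::'a. covered_by (cball p (6 * k + 5)) M"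
    using cball_cover by blast
  have "covered_by (cball x (real n)) (max (2 * M) 1 * Suc n)" for x :: 'a and n
  proof -
    have "covered_by {y. real m \<le> dist x y \<and> dist x y < real m + 1} (2 * M)" for m :: nat
    proof -
      obtain T where T: "finite T" "card T \<le> 2"
        "{y. real m \<le> dist x y \<and> dist x y < real m + 1} \<subseteq> (\<Union>c\<in>T. cball c (6 * k + 5))"
        using annulus_cover[OF assms, of "real m" x] by blast
      show ?thesis
        by (rule covered_by_mono[OF covered_by_UN[OF T(1,2), of "\<lambda>c. cball c (6 * k + 5)" M]])
          (use M T in auto)
    qed
    then have "covered_by (\<Union>m\<in>{..n}. {y. real m \<le> dist x y \<and> dist x y < real m + 1}) (Suc n * (2 * M))"
      by (intro covered_by_UN) auto
    moreover have "cball x (real n) \<subseteq> (\<Union>m\<in>{..n}. {y. real m \<le> dist x y \<and> dist x y < real m + 1})"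
    proof
      fix y assume y: "y \<in> cball x (real n)"
      have "nat \<lfloor>dist x y\<rfloor> \<le> n" "real (nat \<lfloor>dist x y\<rfloor>) \<le> dist x y" "dist x y < real (nat \<lfloor>dist x y\<rfloor>) + 1"
        using y zero_le_dist[of x y] by (simp_all add: nat_le_iff floor_le_iff del: zero_le_dist)
      then show "y \<in> (\<Union>m\<in>{..n}. {y. real m \<le> dist x y \<and> dist x y < real m + 1})"
        by (intro UN_I[of "nat \<lfloor>dist x y\<rfloor>"]) auto
    qed
    ultimately show ?thesis
      by (rule covered_by_mono) (metis max.cobounded1 mult.commute mult_le_mono1)
  qed
  then show ?thesis by (intro exI[of _ "max (2 * M) 1"]) simp
qed

section \<open>Lower bounds for the entropy\<close>

lemma volume_entropy_ge:
  assumes "eventually (\<lambda>R. a * R - b \<le> ln (measure \<mu> (ball x R))) at_top"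
  shows "ereal a \<le> volume_entropy \<mu> x"
proof -
  \<comment> \<open>Passing to e < a leaves the margin (a - e) * R, which outgrows the constant
    b.\<close>
  have "ereal e \<le> volume_entropy \<mu> x" if "e < a" for e
    unfolding volume_entropy_def
  proof (rule Liminf_bounded)
    show "eventually (\<lambda>R. ereal e \<le> ereal (1 / R * ln (measure \<mu> (ball x R)))) at_top"
      using assms eventually_ge_at_top[of "max 1 (b / (a - e))"]
    proof eventually_elim
      case (elim R)
      then have "b \<le> (a - e) * R" "0 < R"
        using that by (auto simp: field_simps)
      then show ?case using elim by (simp add: field_simps)
    qed
  qed
  then show ?thesis
    using ereal_dense2[of "volume_entropy \<mu> x" "ereal a"] by (force simp: not_le[symmetric])
qed

text \<open>Balls of radius at least 1 have measure at least a fixed v > 0, so the logarithm is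
  bounded below. Hence an upper bound H of the entropy is nonnegative, and H = 0 is the only case
  besides H > 0.\<close>

lemma volume_entropy_nonneg: "0 \<le> volume_entropy \<mu> x"
proof -
  obtain v where v: "0 < v" "\<And>p. ennreal v \<le> emeasure \<mu> (ball p 1)"
    using ball_measure_lower_bound[of 1] by auto
  have "eventually (\<lambda>R. 0 * R - (- ln v) \<le> ln (measure \<mu> (ball x R))) at_top"
    using eventually_ge_at_top[of 1]
  proof eventually_elim
    case (elim R)
    have "ennreal v \<le> emeasure \<mu> (ball x R)"
      using elim by (intro order_trans[OF v(2)[of x] emeasure_mono]) (auto simp: sets_eq)
    then have "v \<le> measure \<mu> (ball x R)"
      using emeasure_ball_finite[of x R] v(1) by (simp add: emeasure_eq_ennreal_measure)
    then show ?case using v(1) by simp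
  qed
  then show ?thesis unfolding zero_ereal_def by (rule volume_entropy_ge)
qed

lemma tripod_growth:
  assumes hyp: "gromov_hyperbolic_space TYPE('a) \<delta>"
    and tripod: "has_tripod TYPE('a) \<delta> (14 * \<delta> + 3 * E + 1)"
  shows "\<exists>v>0. \<exists>L>0. \<forall>n (p::'a). ennreal (v * 2 ^ n) \<le> emeasure \<mu> (cball p (real n * L + (7 * \<delta> + E)))"
proof -
  have \<delta>: "0 \<le> \<delta>" using hyp by (simp add: gromov_hyperbolic_space_def)
  \<comment> \<open>The arms chosen below have product at most 4 * \<delta> + E with q, and one more
    four-point inequality adds 3 * \<delta>. The arms of the tripod have length at least 2 * k + E +
    1, which leaves 2 * k + 1 after a displacement by at most E.\<close>
  define k where "k = 7 * \<delta> + E"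
  have k: "0 < k" using \<delta> E_pos by (simp add: k_def)
  note four_point = gromov_product_four_point[OF hyp]
  have "14 * \<delta> + 3 * E + 1 = 2 * k + E + 1" by (simp add: k_def)
  then have "has_tripod TYPE('a) \<delta> (2 * k + E + 1)" using tripod by (simp only:)
  then obtain c :: 'a and a :: "nat \<Rightarrow> 'a" where
    ca: "\<forall>i<3. 2 * k + E + 1 \<le> dist c (a i)" "\<forall>i<3. \<forall>j<3. i \<noteq> j \<longrightarrow> gromov_product c (a i) (a j) \<le> \<delta>"
    unfolding has_tripod_def by blast
  have a: "2 * k + E + 1 \<le> dist c (a i)" if "i < 3" for i
    using ca(1) that by blast
  have a': "gromov_product c (a i) (a j) \<le> \<delta>" if "i < 3" "j < 3" "i \<noteq> j" for i j
    using ca(2) that by blast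
  define L where "L = dist c (a 0) + dist c (a 1) + dist c (a 2) + E"
  have L: "0 < L" using E_pos by (simp add: L_def add_nonneg_pos)
  have aL: "dist c (a i) + E \<le> L" if "i < 3" for i
  proof -
    have "i = 0 \<or> i = 1 \<or> i = 2" using that by linarith
    then show ?thesis by (auto simp: L_def)
  qed
  have branch: "\<exists>b1 b2. dist p b1 \<le> L \<and> dist p b2 \<le> L \<and> 2 * k + 1 \<le> dist p b1 \<and> 2 * k + 1 \<le> dist p b2 \<and>
      gromov_product p b1 q \<le> 4 * \<delta> + E \<and> gromov_product p b2 q \<le> 4 * \<delta> + E \<and>
      gromov_product p b1 b2 \<le> \<delta> + E" for p q :: 'a
  proof -
    obtain f where f: "measured_isometry \<mu> f" and fc: "dist (f c) p \<le> E"
      using homogeneous unfolding homogeneous_within_def by blast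
    have f_dist: "dist (f y) (f z) = dist y z" for y z
      using f by (simp add: measured_isometry_def)
    have b_dist: "dist p (f (a i)) \<le> L \<and> 2 * k + 1 \<le> dist p (f (a i))" if "i < 3" for i
      using a[OF that] aL[OF that] fc dist_triangle[of p "f (a i)" "f c"]
        dist_triangle3[of "f c" "f (a i)" p] f_dist[of c "a i"]
      by (simp add: dist_commute)
    have b_prod: "gromov_product p (f (a i)) (f (a j)) \<le> \<delta> + E" if "i < 3" "j < 3" "i \<noteq> j" for i j
    proof -
      have "gromov_product (f c) (f (a i)) (f (a j)) = gromov_product c (a i) (a j)"
        by (simp add: gromov_product_def f_dist)
      then show ?thesis
        using a'[OF that] fc gromov_product_change_base[of p "f (a i)" "f (a j)" "f c"] by linarith
    qed
    \<comment> \<open>If two arms both violated \<open>P\<close>, the four-point inequality would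
      push their product at p above \<delta> + E. So at most one of the three arms fails.\<close>
    define P where "P = (\<lambda>i. gromov_product p (f (a i)) q \<le> 4 * \<delta> + E)"
    have "P i \<or> P j" if "i < 3" "j < 3" "i \<noteq> j" for i j
      using b_prod[OF that] four_point[of p "f (a i)" q "f (a j)"] gromov_product_commute[of p q "f (a j)"]
      unfolding P_def by linarith
    from this[of 0 1] this[of 0 2] this[of 1 2]
    consider "P 0" "P 1" | "P 0" "P 2" | "P 1" "P 2" by auto
    then obtain i j where "i < 3" "j < 3" "i \<noteq> j" "P i" "P j"
    proof cases
      case 1
      then show thesis by (intro that[of 0 1]) auto
    next
      case 2
      then show thesis by (intro that[of 0 2]) auto
    next
      case 3
      then show thesis by (intro that[of 1 2]) auto
    qed
    then have "i < 3" "j < 3" "i \<noteq> j" "gromov_product p (f (a i)) q \<le> 4 * \<delta> + E"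
      "gromov_product p (f (a j)) q \<le> 4 * \<delta> + E"
      unfolding P_def by blast+
    then show ?thesis using b_dist[of i] b_dist[of j] b_prod[of i j] by blast
  qed
  txt \<open>\<open>F p q n\<close> consists of the points of a large ball that are seen from \<open>p\<close> in a direction different
    from \<open>q\<close>. At least two of the three arms at \<open>p\<close> point away from \<open>q\<close>, and the sets \<open>F b p n\<close> at their
    ends \<open>b\<close> are disjoint subsets of \<open>F p q (Suc n)\<close>.\<close>
  define F where "F = (\<lambda>p q n. cball p (real n * L + k) \<inter> {z::'a. gromov_product p z q \<le> k})"
  have F_sets: "F p q n \<in> sets \<mu>" for p q n
  proof -
    have "closed (F p q n)"
      unfolding F_def gromov_product_def by (intro closed_Int closed_cball closed_Collect_le continuous_intros) auto
    then show ?thesis by (simp add: sets_eq)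
  qed
  obtain v where v: "0 < v" "\<And>p. ennreal v \<le> emeasure \<mu> (ball p k)"
    using ball_measure_lower_bound[OF k] by blast
  have "ennreal (v * 2 ^ n) \<le> emeasure \<mu> (F p q n)" for n p q
  proof (induction n arbitrary: p q)
    case 0
    have "emeasure \<mu> (ball p k) \<le> emeasure \<mu> (F p q 0)"
    proof (rule emeasure_mono)
      show "ball p k \<subseteq> F p q 0"
        using gromov_product_le_dist[of p _ q] by (force simp: F_def intro: order_trans)
    qed (rule F_sets)
    then show ?case using v(2)[of p] by simp
  next
    case (Suc n)
    obtain b1 b2 where b: "dist p b1 \<le> L" "dist p b2 \<le> L" "2 * k + 1 \<le> dist p b1" "2 * k + 1 \<le> dist p b2"
      "gromov_product p b1 q \<le> 4 * \<delta> + E" "gromov_product p b2 q \<le> 4 * \<delta> + E"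
      "gromov_product p b1 b2 \<le> \<delta> + E"
      using branch by blast
    \<comment> \<open>\<open>dist p b\<close> is the sum of a product at p and a product at b, and
      the latter is at most k on \<open>F b p n\<close>. The excess of 1 over k separates the
      directions in the next two claims.\<close>
    have prod_ge: "k + 1 \<le> gromov_product p z b" if "z \<in> F b p n" "2 * k + 1 \<le> dist p b" for z b
      using that gromov_product_swap[of b p z] gromov_product_commute[of b z p]
        gromov_product_commute[of p z b] by (simp add: F_def)
    have sub: "F b p n \<subseteq> F p q (Suc n)"
      if "dist p b \<le> L" "2 * k + 1 \<le> dist p b" "gromov_product p b q \<le> 4 * \<delta> + E" for b
    proof
      fix z assume z: "z \<in> F b p n"
      have "min (gromov_product p b z) (gromov_product p z q) \<le> k"
        using four_point[of p b z q] that(3) by (simp add: k_def)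
      then have "gromov_product p z q \<le> k"
        using prod_ge[OF z that(2)] gromov_product_commute[of p b z] by linarith
      then show "z \<in> F p q (Suc n)"
        using z that(1) dist_triangle[of p z b] by (simp add: F_def algebra_simps)
    qed
    have "F b1 p n \<inter> F b2 p n = {}"
    proof (rule ccontr)
      assume "F b1 p n \<inter> F b2 p n \<noteq> {}"
      then obtain z where z: "z \<in> F b1 p n" "z \<in> F b2 p n" by blast
      then show False
        using prod_ge[OF z(1) b(3)] prod_ge[OF z(2) b(4)] b(7) four_point[of p b1 z b2] \<delta>
          gromov_product_commute[of p b1 z] by (simp add: k_def)
    qed
    then have "emeasure \<mu> (F b1 p n) + emeasure \<mu> (F b2 p n) = emeasure \<mu> (F b1 p n \<union> F b2 p n)"
      by (rule plus_emeasure[OF F_sets F_sets])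
    also have "\<dots> \<le> emeasure \<mu> (F p q (Suc n))"
      using sub[OF b(1,3,5)] sub[OF b(2,4,6)] by (intro emeasure_mono F_sets) auto
    finally have "ennreal (v * 2 ^ n) + ennreal (v * 2 ^ n) \<le> emeasure \<mu> (F p q (Suc n))"
      using add_mono[OF Suc Suc] by (rule order_trans[rotated])
    moreover have "ennreal (v * 2 ^ n + v * 2 ^ n) = ennreal (v * 2 ^ n) + ennreal (v * 2 ^ n)"
      by (rule ennreal_plus) (use v(1) in auto)
    moreover have "v * 2 ^ Suc n = v * 2 ^ n + v * 2 ^ n"
      by simp
    ultimately show ?case by (simp only:)
  qed
  moreover have "emeasure \<mu> (F p q n) \<le> emeasure \<mu> (cball p (real n * L + k))" for p q n
    by (intro emeasure_mono) (auto simp: F_def sets_eq)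
  ultimately have "ennreal (v * 2 ^ n) \<le> emeasure \<mu> (cball p (real n * L + k))" for n and p :: 'a
    by (rule order_trans)
  then show ?thesis
    using v(1) L unfolding k_def by blast
qed

lemma tripod_imp_entropy_pos:
  assumes hyp: "gromov_hyperbolic_space TYPE('a) \<delta>"
    and tripod: "has_tripod TYPE('a) \<delta> (14 * \<delta> + 3 * E + 1)"
  shows "0 < volume_entropy \<mu> x"
proof -
  obtain v L where vL: "0 < v" "0 < L"
    "\<And>n p. ennreal (v * 2 ^ n) \<le> emeasure \<mu> (cball (p::'a) (real n * L + (7 * \<delta> + E)))"
    using tripod_growth[OF assms] by blast
  \<comment> \<open>The summand 1 puts the closed ball into the open ball of radius R.\<close>
  define b where "b = 7 * \<delta> + E + 1"
  have "eventually (\<lambda>R. (ln 2 / L) * R - ((b / L + 1) * ln 2 - ln v) \<le> ln (measure \<mu> (ball x R))) at_top"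
    using eventually_ge_at_top[of b]
  proof eventually_elim
    case (elim R)
    define n where "n = nat \<lfloor>(R - b) / L\<rfloor>"
    have "0 \<le> (R - b) / L" using elim vL by simp
    then have n: "real n \<le> (R - b) / L" "(R - b) / L - 1 \<le> real n"
      unfolding n_def by linarith+
    have "real n * L \<le> R - b" using n(1) vL(2) by (simp add: pos_le_divide_eq)
    then have "ennreal (v * 2 ^ n) \<le> emeasure \<mu> (ball x R)"
      by (intro order_trans[OF vL(3)[of n x] emeasure_mono]) (auto simp: b_def sets_eq)
    then have m: "v * 2 ^ n \<le> measure \<mu> (ball x R)"
      using emeasure_ball_finite[of x R] vL(1) by (simp add: emeasure_eq_ennreal_measure)
    have "((R - b) / L - 1) * ln 2 \<le> real n * ln 2"
      using n(2) by (intro mult_right_mono) auto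
    also have "\<dots> + ln v = ln (v * 2 ^ n)"
      using vL(1) by (simp add: ln_mult ln_realpow)
    also have "ln (v * 2 ^ n) \<le> ln (measure \<mu> (ball x R))"
      using m vL(1) by (subst ln_le_cancel_iff) (auto intro: less_le_trans[OF _ m])
    finally show ?case using vL(2) by (simp add: field_simps)
  qed
  then have "ereal (ln 2 / L) \<le> volume_entropy \<mu> x" by (rule volume_entropy_ge)
  moreover have "0 < ereal (ln 2 / L)" using vL(2) by simp
  ultimately show ?thesis by (rule less_le_trans[rotated])
qed

end

section \<open>The Poincare inequality from covers\<close>

lemma powr_add_le:
  fixes a b \<sigma> :: real
  assumes "0 \<le> a" "0 \<le> b" "0 \<le> \<sigma>"
  shows "(a + b) powr \<sigma> \<le> 2 powr \<sigma> * (a powr \<sigma> + b powr \<sigma>)"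
proof -
  have "(a + b) powr \<sigma> \<le> (2 * max a b) powr \<sigma>"
    using assms by (intro powr_mono2) auto
  also have "\<dots> = 2 powr \<sigma> * max a b powr \<sigma>"
    using assms by (simp add: powr_mult)
  also have "\<dots> \<le> 2 powr \<sigma> * (a powr \<sigma> + b powr \<sigma>)"
    by (intro mult_left_mono) (auto simp: max_def)
  finally show ?thesis .
qed

lemma abs_diff_powr_le:
  fixes a b c \<sigma> :: real
  assumes "0 \<le> \<sigma>"
  shows "\<bar>a - c\<bar> powr \<sigma> \<le> 2 powr \<sigma> * (\<bar>a - b\<bar> powr \<sigma> + \<bar>b - c\<bar> powr \<sigma>)"
proof -
  have "\<bar>a - c\<bar> powr \<sigma> \<le> (\<bar>a - b\<bar> + \<bar>b - c\<bar>) powr \<sigma>"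
    using assms by (intro powr_mono2) auto
  also have "\<dots> \<le> 2 powr \<sigma> * (\<bar>a - b\<bar> powr \<sigma> + \<bar>b - c\<bar> powr \<sigma>)"
    using assms by (intro powr_add_le) auto
  finally show ?thesis .
qed

text \<open>For t > s one has t powr (1 - \<sigma>) \<le> s powr (1 - \<sigma>), as the exponent is
  not positive. Integrated with a suitable s, this replaces Jensen's inequality.\<close>

lemma le_add_powr:
  fixes s t \<sigma> :: real
  assumes "0 < s" "0 \<le> t" "1 \<le> \<sigma>"
  shows "t \<le> s + s powr (1 - \<sigma>) * t powr \<sigma>"
proof (cases "t \<le> s")
  case True
  then show ?thesis using assms by (simp add: add_increasing2)
next
  case False
  then have "t powr (1 - \<sigma>) \<le> s powr (1 - \<sigma>)"
    using assms by (intro powr_mono2') auto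
  then have "t powr (1 - \<sigma>) * t powr \<sigma> \<le> s powr (1 - \<sigma>) * t powr \<sigma>"
    by (intro mult_right_mono) auto
  moreover have "t powr (1 - \<sigma>) * t powr \<sigma> = t"
    using False assms by (simp add: powr_add[symmetric])
  ultimately show ?thesis using assms by linarith
qed

section \<open>Means and oscillations on balls\<close>

context homogeneous_measured_space
begin

lemma set_integrable_continuous:
  fixes f :: "'a \<Rightarrow> real"
  assumes "continuous_on UNIV f"
  shows "set_integrable \<mu> (ball x r) f"
proof -
  have "f \<in> borel_measurable borel"
    using assms by (rule borel_measurable_continuous_onI)
  then have f: "f \<in> borel_measurable \<mu>"
    by (simp add: measurable_cong_sets[OF sets_eq refl])
  have "compact (f ` cball x r)"
    using compact_cball continuous_on_subset[OF assms] by (intro compact_continuous_image) auto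
  then have "bounded (f ` cball x r)" by (rule compact_imp_bounded)
  then obtain B where "\<forall>z\<in>f ` cball x r. norm z \<le> B" unfolding bounded_iff by blast
  then have B: "norm (f y) \<le> B" if "y \<in> cball x r" for y using that by blast
  show ?thesis
    unfolding set_integrable_def
  proof (rule integrableI_bounded_set[where A = "ball x r" and B = B])
    show "ball x r \<in> sets \<mu>" by (simp add: sets_eq)
    then show "(\<lambda>y. indicat_real (ball x r) y *\<^sub>R f y) \<in> borel_measurable \<mu>"
      using f by (intro borel_measurable_scaleR borel_measurable_indicator)
    show "emeasure \<mu> (ball x r) < \<infinity>" by (rule emeasure_ball_finite)
    show "AE y\<in>ball x r in \<mu>. norm (indicat_real (ball x r) y *\<^sub>R f y) \<le> B"
      using B by auto
  qed auto
qed

lemma continuous_powr_diff: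
  assumes "continuous_on UNIV (u :: 'a \<Rightarrow> real)" "1 \<le> \<sigma>"
  shows "continuous_on UNIV (\<lambda>y. \<bar>u y - a\<bar> powr \<sigma>)"
  using assms by (intro continuous_on_powr' continuous_intros) auto

lemmas set_integrable_powr_diff = set_integrable_continuous[OF continuous_powr_diff]

lemma measure_ball_pos: "0 < r \<Longrightarrow> 0 < measure \<mu> (ball x r)"
  using emeasure_ball_pos[of r x] emeasure_ball_finite[of x r]
  by (simp add: measure_def enn2real_positive_iff)

lemma emeasure_ball_eq: "emeasure \<mu> (ball x r) = ennreal (measure \<mu> (ball x r))"
  using emeasure_ball_finite[of x r] by (intro emeasure_eq_ennreal_measure) auto

lemma set_integral_const_ball: "(LINT y:ball x r|\<mu>. (c::real)) = measure \<mu> (ball x r) * c"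
  using emeasure_ball_finite[of x r] by (simp add: sets_eq set_integral_const)

lemma oscillation_integral_eq:
  assumes "continuous_on UNIV u" "1 \<le> \<sigma>"
  shows "oscillation_integral \<mu> \<sigma> u x r
    = ennreal (LINT y:ball x r|\<mu>. \<bar>u y - ball_mean \<mu> u x r\<bar> powr \<sigma>)"
  unfolding oscillation_integral_def nn_integral_set_ennreal set_lebesgue_integral_def
  using set_integrable_powr_diff[OF assms, of x r "ball_mean \<mu> u x r"]
  by (subst nn_integral_eq_integral) (auto simp: set_integrable_def mult.commute)

text \<open>A weak form of Jensen's inequality: integrate \<open>t \<le> s + s\<^bsup>1-\<sigma>\<^esup> t\<^bsup>\<sigma>\<^esup>\<close> for
  \<open>t = \<bar>u y - a\<bar>\<close>, with \<open>s\<close> half of the left-hand deviation.\<close>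

lemma ball_mean_diff_powr:
  assumes u: "continuous_on UNIV u" and \<sigma>: "1 \<le> \<sigma>" and r: "0 < r"
  shows "\<bar>ball_mean \<mu> u x r - a\<bar> powr \<sigma> * measure \<mu> (ball x r)
    \<le> 2 powr \<sigma> * (LINT y:ball x r|\<mu>. \<bar>u y - a\<bar> powr \<sigma>)"
proof (cases "ball_mean \<mu> u x r = a")
  case True
  then show ?thesis
    by (auto simp: set_lebesgue_integral_def intro!: mult_nonneg_nonneg integral_nonneg_AE)
next
  case False
  define m where "m = measure \<mu> (ball x r)"
  define s where "s = \<bar>ball_mean \<mu> u x r - a\<bar> / 2"
  define J where "J = (LINT y:ball x r|\<mu>. \<bar>u y - a\<bar> powr \<sigma>)"
  have s: "0 < s" and m: "0 < m"
    using False measure_ball_pos[OF r] by (auto simp: s_def m_def)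
  note int = set_integrable_continuous[of _ x r]
  have ua: "continuous_on UNIV (\<lambda>y. u y - a)" "continuous_on UNIV (\<lambda>y. \<bar>u y - a\<bar>)"
    using u by (auto intro!: continuous_intros)
  have "(LINT y:ball x r|\<mu>. u y - a) = (LINT y:ball x r|\<mu>. u y) - m * a"
    using int[OF u] int[of "\<lambda>_. a"] by (simp add: set_integral_const_ball m_def)
  also have "(LINT y:ball x r|\<mu>. u y) = m * ball_mean \<mu> u x r"
    using m by (simp add: ball_mean_def m_def)
  finally have "(LINT y:ball x r|\<mu>. u y - a) = m * (ball_mean \<mu> u x r - a)"
    by (simp add: right_diff_distrib)
  then have "2 * s * m = \<bar>LINT y:ball x r|\<mu>. u y - a\<bar>"
    using m by (simp add: s_def abs_mult)
  also have "\<dots> \<le> (LINT y:ball x r|\<mu>. \<bar>u y - a\<bar>)"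
    using set_integral_norm_bound[OF int[OF ua(1)]] by simp
  also have "\<dots> \<le> (LINT y:ball x r|\<mu>. s + s powr (1 - \<sigma>) * \<bar>u y - a\<bar> powr \<sigma>)"
    using s \<sigma> by (intro set_integral_mono int continuous_on_mult continuous_on_add
        continuous_on_const continuous_powr_diff u ua(2) le_add_powr) auto
  also have "\<dots> = m * s + s powr (1 - \<sigma>) * J"
    using int[of "\<lambda>_. s"] set_integrable_powr_diff[OF u \<sigma>, of x r a]
    by (simp add: set_integral_const_ball m_def J_def)
  \<comment> \<open>The term m * s on the right cancels half of 2 * s * m.\<close>
  finally have "s * m \<le> s powr (1 - \<sigma>) * J"
    by (simp add: mult.commute[of m s])
  then have "s powr (\<sigma> - 1) * (s * m) \<le> s powr (\<sigma> - 1) * (s powr (1 - \<sigma>) * J)"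
    by (rule mult_left_mono) simp
  moreover have "s powr (\<sigma> - 1) * s = s powr \<sigma>" "s powr (\<sigma> - 1) * s powr (1 - \<sigma>) = 1"
    using s by (auto simp: powr_diff powr_add[symmetric])
  ultimately have "s powr \<sigma> * m \<le> J" by (simp flip: mult.assoc)
  then have "2 powr \<sigma> * (s powr \<sigma> * m) \<le> 2 powr \<sigma> * J" by simp
  moreover have "2 powr \<sigma> * s powr \<sigma> = \<bar>ball_mean \<mu> u x r - a\<bar> powr \<sigma>"
    by (simp add: s_def powr_mult[symmetric])
  ultimately show ?thesis by (simp add: m_def J_def flip: mult.assoc)
qed

text \<open>Used to replace the mean over a small ball by the mean at the centre of the large ball,
  and then the latter by the mean over the large ball.\<close>

lemma oscillation_le_any_constant:
  assumes u: "continuous_on UNIV u" and \<sigma>: "1 \<le> \<sigma>" and r: "0 < r"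
  shows "(LINT y:ball x r|\<mu>. \<bar>u y - b\<bar> powr \<sigma>)
    \<le> 2 powr \<sigma> * ((LINT y:ball x r|\<mu>. \<bar>u y - a\<bar> powr \<sigma>) + \<bar>a - b\<bar> powr \<sigma> * measure \<mu> (ball x r))"
proof -
  have "(LINT y:ball x r|\<mu>. \<bar>u y - b\<bar> powr \<sigma>)
    \<le> (LINT y:ball x r|\<mu>. 2 powr \<sigma> * (\<bar>u y - a\<bar> powr \<sigma> + \<bar>a - b\<bar> powr \<sigma>))"
    using \<sigma> by (intro set_integral_mono set_integrable_continuous continuous_on_mult continuous_on_add
        continuous_on_const continuous_powr_diff u abs_diff_powr_le) auto
  also have "\<dots> = 2 powr \<sigma> * ((LINT y:ball x r|\<mu>. \<bar>u y - a\<bar> powr \<sigma>) + \<bar>a - b\<bar> powr \<sigma> * measure \<mu> (ball x r))"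
    using set_integrable_powr_diff[OF u \<sigma>, of x r a] set_integrable_continuous[of "\<lambda>_. \<bar>a - b\<bar> powr \<sigma>" x r]
    by (simp add: set_integral_const_ball mult.commute)
  finally show ?thesis .
qed

lemma set_integral_le_cover:
  fixes f :: "'a \<Rightarrow> real"
  assumes f: "continuous_on UNIV f" "\<And>y. 0 \<le> f y" and T: "finite T" "ball x R \<subseteq> (\<Union>c\<in>T. ball c r)"
  shows "(LINT y:ball x R|\<mu>. f y) \<le> (\<Sum>c\<in>T. (LINT y:ball c r|\<mu>. f y))"
proof -
  have int: "integrable \<mu> (\<lambda>y. indicat_real (ball c s) y * f y)" for c s
    using set_integrable_continuous[OF f(1), of c s] by (simp add: set_integrable_def)
  have "(LINT y:ball x R|\<mu>. f y) \<le> (LINT y|\<mu>. (\<Sum>c\<in>T. indicat_real (ball c r) y * f y))"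
    unfolding set_lebesgue_integral_def real_scaleR_def
  proof (rule integral_mono)
    fix y
    have "indicat_real (ball x R) y \<le> (\<Sum>c\<in>T. indicat_real (ball c r) y)"
    proof (cases "y \<in> ball x R")
      case True
      then obtain c where "c \<in> T" "y \<in> ball c r" using T(2) by blast
      then have "indicat_real (ball x R) y \<le> indicat_real (ball c r) y" by simp
      also have "\<dots> \<le> (\<Sum>c\<in>T. indicat_real (ball c r) y)"
        using T(1) \<open>c \<in> T\<close> by (intro member_le_sum) auto
      finally show ?thesis .
    qed (simp add: sum_nonneg)
    then show "indicat_real (ball x R) y * f y \<le> (\<Sum>c\<in>T. indicat_real (ball c r) y * f y)"
      unfolding sum_distrib_right[symmetric] by (intro mult_right_mono f(2))
  qed (use int in auto)
  then show ?thesis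
    using int by (simp add: set_lebesgue_integral_def)
qed

lemma gradient_integral_mono:
  "ball x r \<subseteq> ball y s \<Longrightarrow> gradient_integral \<mu> \<sigma> g x r \<le> gradient_integral \<mu> \<sigma> g y s"
  unfolding gradient_integral_def by (rule nn_set_integral_set_mono)

text \<open>Along a geodesic, n steps of length at most 1/2 lead from x to y. A single step is
  controlled only when it starts within \<rho> of x, which the intermediate points respect.\<close>

lemma chain_bound:
  fixes m :: "'a \<Rightarrow> real"
  assumes step: "\<And>z y. dist x z \<le> \<rho> \<Longrightarrow> dist z y \<le> 1/2 \<Longrightarrow> \<bar>m y - m z\<bar> \<le> B"
  shows "real n / 2 \<le> \<rho> \<Longrightarrow> dist x y \<le> real n / 2 \<Longrightarrow> \<bar>m y - m x\<bar> \<le> real n * B"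
proof (induction n arbitrary: y)
  case (Suc n)
  then have "dist x y \<le> real n / 2 + 1 / 2" by (simp add: field_simps)
  then obtain z where z: "dist x z \<le> real n / 2" "dist z y \<le> 1 / 2"
    using geodesic_intermediate_point[OF proper_geodesic, of "real n / 2" "1 / 2" x y] by auto
  then have "\<bar>m z - m x\<bar> \<le> real n * B" "\<bar>m y - m z\<bar> \<le> B"
    using Suc by (auto intro!: Suc.IH step)
  then show ?case by (simp add: algebra_simps)
qed simp

text \<open>The last factor of \<open>K\<close> bounds the deviation from the mean at x on one small
  ball: its own oscillation gives C, the chain of means gives 4 powr \<sigma> * C * V / v. The
  factor 2 powr \<sigma> * (1 + 2 powr \<sigma>) pays for the passage to the mean over
  \<open>ball x R\<close>.\<close>

lemma poincare_from_cover:
  assumes u: "continuous_on UNIV u" and \<sigma>: "1 \<le> \<sigma>"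
    and C: "0 < C"
    and loc: "\<And>z r. 0 < r \<Longrightarrow> r \<le> 1 \<Longrightarrow>
      oscillation_integral \<mu> \<sigma> u z r \<le> ennreal C * gradient_integral \<mu> \<sigma> g z r"
    and v: "0 < v" "\<And>p. ennreal v \<le> emeasure \<mu> (ball p (1/2))"
    and V: "0 < V" "\<And>p. emeasure \<mu> (ball p (1/2)) \<le> ennreal V"
    and cover: "covered_by (ball x R) N"
    and R: "0 < R" "R + 1/2 \<le> real n / 2"
    and A: "0 \<le> A" "gradient_integral \<mu> \<sigma> g x (real n / 2 + 1) \<le> ennreal A"
  defines "K \<equiv> 2 powr \<sigma> * (1 + 2 powr \<sigma>) * (2 powr \<sigma> * (C + 4 powr \<sigma> * C * V / v))"
  shows "oscillation_integral \<mu> \<sigma> u x R \<le> ennreal (K * real N * real n powr \<sigma> * A)"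
proof -
  have mv: "v \<le> measure \<mu> (ball p (1/2))" and mV: "measure \<mu> (ball p (1/2)) \<le> V" for p
    using v V emeasure_ball_eq[of p "1/2"] by (metis ennreal_le_iff measure_nonneg less_imp_le)+
  define m where "m = (\<lambda>p. ball_mean \<mu> u p (1/2))"
  \<comment> \<open>The unit for one link: a deviation whose \<sigma>-th power integrates to at most
    C * A over a set of measure at least v.\<close>
  define B where "B = (C * A / v) powr (1 / \<sigma>)"
  have B: "0 \<le> B" "B powr \<sigma> = C * A / v"
    using \<sigma> C A v by (auto simp: B_def powr_powr)
  have local_bound: "(LINT y:ball z r|\<mu>. \<bar>u y - ball_mean \<mu> u z r\<bar> powr \<sigma>) \<le> C * A"
    if "0 < r" "r \<le> 1" "dist x z \<le> real n / 2" for z r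
  proof -
    have "ball z r \<subseteq> ball x (real n / 2 + 1)"
    proof
      fix y assume "y \<in> ball z r"
      then show "y \<in> ball x (real n / 2 + 1)"
        using that dist_triangle[of x y z] by simp
    qed
    then have "gradient_integral \<mu> \<sigma> g z r \<le> ennreal A"
      using gradient_integral_mono A(2) order_trans by blast
    then have "oscillation_integral \<mu> \<sigma> u z r \<le> ennreal C * ennreal A"
      using loc[OF that(1,2), of z] by (meson mult_left_mono order_trans zero_le)
    also have "\<dots> = ennreal (C * A)" using C A by (simp add: ennreal_mult)
    finally show ?thesis
      using C A by (simp add: oscillation_integral_eq[OF u \<sigma>])
  qed
  have near: "\<bar>m y - ball_mean \<mu> u z 1\<bar> \<le> 2 * B" if "dist x z \<le> real n / 2" "dist z y \<le> 1/2" for z y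
  proof -
    define a where "a = ball_mean \<mu> u z 1"
    have sub: "ball y (1/2) \<subseteq> ball z 1"
    proof
      fix w assume "w \<in> ball y (1/2)"
      then show "w \<in> ball z 1" using that dist_triangle[of z w y] by simp
    qed
    have "\<bar>m y - a\<bar> powr \<sigma> * v \<le> \<bar>m y - a\<bar> powr \<sigma> * measure \<mu> (ball y (1/2))"
      using mv by (intro mult_left_mono) auto
    also have "\<dots> \<le> 2 powr \<sigma> * (LINT y:ball y (1/2)|\<mu>. \<bar>u y - a\<bar> powr \<sigma>)"
      unfolding m_def by (rule ball_mean_diff_powr[OF u \<sigma>]) simp
    also have "(LINT y:ball y (1/2)|\<mu>. \<bar>u y - a\<bar> powr \<sigma>) \<le> (LINT y:ball z 1|\<mu>. \<bar>u y - a\<bar> powr \<sigma>)"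
      using set_integral_le_cover[OF continuous_powr_diff[OF u \<sigma>, of a], where T = "{z}" and x = y and R = "1/2" and r = 1] sub
      by simp
    also have "\<dots> \<le> C * A"
      unfolding a_def using that by (intro local_bound) auto
    finally have "\<bar>m y - a\<bar> powr \<sigma> * v \<le> 2 powr \<sigma> * (C * A)" by simp
    then have "\<bar>m y - a\<bar> powr \<sigma> \<le> 2 powr \<sigma> * B powr \<sigma>"
      using v(1) by (simp add: B(2) pos_le_divide_eq)
    also have "\<dots> = (2 * B) powr \<sigma>" using B by (simp add: powr_mult)
    finally show ?thesis
      using powr_less_mono2[of \<sigma> "2 * B" "\<bar>m y - a\<bar>"] \<sigma> B(1) unfolding a_def by force
  qed
  \<comment> \<open>The means over the half balls at y and at z are both compared with the mean over
    \<open>ball z 1\<close>.\<close>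
  have step: "\<bar>m y - m z\<bar> \<le> 4 * B" if "dist x z \<le> real n / 2" "dist z y \<le> 1/2" for z y
    using near[OF that] near[OF that(1), of z] by simp
  obtain T where T: "finite T" "card T \<le> N" "ball x R \<subseteq> (\<Union>c\<in>T. ball c (1/2))"
    using cover unfolding covered_by_def by blast
  \<comment> \<open>Centres of the cover may lie beyond the reach of the chain estimate. Those whose
    balls meet \<open>ball x R\<close> survive because R + 1/2 \<le> n / 2.\<close>
  define T' where "T' = {c \<in> T. dist x c \<le> real n / 2}"
  have T': "finite T'" "card T' \<le> N"
    using T card_mono[OF T(1), of T'] by (auto simp: T'_def)
  have "ball x R \<subseteq> (\<Union>c\<in>T'. ball c (1/2))"
  proof
    fix y assume y: "y \<in> ball x R"
    then obtain c where c: "c \<in> T" "y \<in> ball c (1/2)" using T by blast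
    then have "dist x c \<le> real n / 2"
      using y R(2) dist_triangle2[of x c y] by simp
    then show "y \<in> (\<Union>c\<in>T'. ball c (1/2))" using c by (auto simp: T'_def)
  qed
  note cov = set_integral_le_cover[OF continuous_powr_diff[OF u \<sigma>] _ T'(1) this, of "m x", simplified]
  \<comment> \<open>This lets the oscillation inside one small ball carry the factor n powr \<sigma>
    as well, like the contribution of the chain.\<close>
  have n1: "1 \<le> real n powr \<sigma>"
    using R \<sigma> by (intro ge_one_powr_ge_zero) (auto simp: field_simps)
  have each: "(LINT y:ball c (1/2)|\<mu>. \<bar>u y - m x\<bar> powr \<sigma>)
      \<le> 2 powr \<sigma> * (C + 4 powr \<sigma> * C * V / v) * real n powr \<sigma> * A" if "c \<in> T'" for c
  proof -
    have c: "dist x c \<le> real n / 2" using that by (simp add: T'_def)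
    have "\<bar>m c - m x\<bar> \<le> real n * (4 * B)"
      by (rule chain_bound[where \<rho> = "real n / 2", OF step]) (use c in auto)
    then have "\<bar>m c - m x\<bar> powr \<sigma> \<le> (real n * (4 * B)) powr \<sigma>"
      using \<sigma> by (intro powr_mono2) auto
    also have "\<dots> = real n powr \<sigma> * (4 powr \<sigma> * (C * A / v))"
      using B by (simp add: powr_mult)
    finally have "\<bar>m c - m x\<bar> powr \<sigma> * measure \<mu> (ball c (1/2)) \<le> real n powr \<sigma> * (4 powr \<sigma> * (C * A / v)) * V"
      using mV[of c] C A v by (intro mult_mono) auto
    moreover have "1 * (C * A) \<le> real n powr \<sigma> * (C * A)"
      by (rule mult_right_mono[OF n1]) (use C A in auto)
    then have "(LINT y:ball c (1/2)|\<mu>. \<bar>u y - m c\<bar> powr \<sigma>) \<le> real n powr \<sigma> * (C * A)"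
      using local_bound[of "1/2" c] c unfolding m_def by linarith
    ultimately have "2 powr \<sigma> * ((LINT y:ball c (1/2)|\<mu>. \<bar>u y - m c\<bar> powr \<sigma>)
          + \<bar>m c - m x\<bar> powr \<sigma> * measure \<mu> (ball c (1/2)))
        \<le> 2 powr \<sigma> * (real n powr \<sigma> * (C * A) + real n powr \<sigma> * (4 powr \<sigma> * (C * A / v)) * V)"
      by (intro mult_left_mono add_mono) auto
    then have "(LINT y:ball c (1/2)|\<mu>. \<bar>u y - m x\<bar> powr \<sigma>)
        \<le> 2 powr \<sigma> * (real n powr \<sigma> * (C * A) + real n powr \<sigma> * (4 powr \<sigma> * (C * A / v)) * V)"
      by (rule order_trans[OF oscillation_le_any_constant[OF u \<sigma> half_gt_zero[OF zero_less_one]]])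
    also have "\<dots> = 2 powr \<sigma> * (C + 4 powr \<sigma> * C * V / v) * real n powr \<sigma> * A"
      by (simp add: field_simps)
    finally show ?thesis .
  qed
  define Q where "Q = 2 powr \<sigma> * (C + 4 powr \<sigma> * C * V / v) * real n powr \<sigma> * A"
  have Q: "0 \<le> Q" using C V v A by (simp add: Q_def)
  have "(LINT y:ball x R|\<mu>. \<bar>u y - m x\<bar> powr \<sigma>) \<le> (\<Sum>c\<in>T'. Q)"
    using each by (intro order_trans[OF cov sum_mono]) (simp add: Q_def)
  also have "\<dots> \<le> real N * Q" using T' Q by (simp add: mult_right_mono)
  finally have J: "(LINT y:ball x R|\<mu>. \<bar>u y - m x\<bar> powr \<sigma>) \<le> real N * Q" .
  define a where "a = ball_mean \<mu> u x R"
  have "(LINT y:ball x R|\<mu>. \<bar>u y - a\<bar> powr \<sigma>)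
      \<le> 2 powr \<sigma> * ((LINT y:ball x R|\<mu>. \<bar>u y - m x\<bar> powr \<sigma>) + \<bar>m x - a\<bar> powr \<sigma> * measure \<mu> (ball x R))"
    by (rule oscillation_le_any_constant[OF u \<sigma> R(1)])
  also have "\<dots> \<le> 2 powr \<sigma> * (real N * Q + 2 powr \<sigma> * (real N * Q))"
  proof (intro mult_left_mono add_mono J)
    show "\<bar>m x - a\<bar> powr \<sigma> * measure \<mu> (ball x R) \<le> 2 powr \<sigma> * (real N * Q)"
      using order_trans[OF ball_mean_diff_powr[OF u \<sigma> R(1), of x "m x"] mult_left_mono[OF J]]
      by (simp add: a_def abs_minus_commute)
  qed simp
  also have "\<dots> = K * real N * real n powr \<sigma> * A"
    by (simp add: K_def Q_def algebra_simps add_divide_distrib)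
  finally show ?thesis
    unfolding oscillation_integral_eq[OF u \<sigma>] a_def by (rule ennreal_leI)
qed

end

text \<open>As R / R0 \<ge> 1, raising the exponent of R by e costs only the factor R0 powr - e.
  This is one place where the positive threshold counts.\<close>

lemma powr_le_powr_add:
  fixes a e R R0 :: real
  assumes "0 < R0" "R0 \<le> R" "0 \<le> e"
  shows "R powr a \<le> R0 powr - e * R powr (a + e)"
proof -
  have "R0 powr e \<le> R powr e" using assms by (intro powr_mono2) auto
  then have "1 \<le> R0 powr - e * R powr e"
    using assms by (simp add: powr_minus field_simps)
  then have "1 * R powr a \<le> R0 powr - e * R powr e * R powr a"
    by (intro mult_right_mono) auto
  then show ?thesis by (simp add: powr_add mult_ac)
qed

section \<open>From covering numbers to large radii\<close>

context homogeneous_measured_space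
begin

text \<open>The chain and the unit balls around it reach radius n / 2 + 1 \<le> R + 2, and 1 + 2 /
  R0 is the factor that makes this a multiple of R for all R \<ge> R0.\<close>

lemma poincare_from_growth:
  fixes N :: "real \<Rightarrow> nat"
  assumes \<sigma>: "1 \<le> \<sigma>" and r0: "1 \<le> r0" and loc: "local_poincare \<mu> \<sigma> r0"
    and R0: "0 < R0" and M: "0 < M" and \<Lambda>: "1 + 2 / R0 \<le> \<Lambda>"
    and cover: "\<And>(x::'a) R. R0 \<le> R \<Longrightarrow> covered_by (ball x R) (N R)"
    and growth: "\<And>R. R0 \<le> R \<Longrightarrow> real (N R) \<le> M * R powr b * exp (\<kappa> * R)"
  shows "\<exists>C0>0. \<forall>(u::'a \<Rightarrow> real) g. continuous_on UNIV u \<longrightarrow> upper_gradient u g \<longrightarrow>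
    (\<forall>R x. R0 \<le> R \<longrightarrow> oscillation_integral \<mu> \<sigma> u x R \<le>
      ennreal (C0 * R powr (\<sigma> + b) * exp (\<kappa> * R)) * gradient_integral \<mu> \<sigma> g x (2 * \<Lambda> * R))"
proof -
  obtain C where C: "0 < C" and locC: "\<forall>u g. continuous_on UNIV u \<longrightarrow> upper_gradient u g \<longrightarrow>
      (\<forall>x R. 0 < R \<longrightarrow> R \<le> r0 \<longrightarrow>
        oscillation_integral \<mu> \<sigma> u x R \<le> ennreal C * gradient_integral \<mu> \<sigma> g x R)"
    using loc unfolding local_poincare_def by blast
  obtain v where v: "0 < v" "\<And>p. ennreal v \<le> emeasure \<mu> (ball p (1/2))"
    using ball_measure_lower_bound[of "1/2"] by auto
  obtain V where V: "0 < V" "\<And>p. emeasure \<mu> (ball p (1/2)) \<le> ennreal V"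
    using ball_measure_upper_bound[of "1/2"] by auto
  define K where "K = 2 powr \<sigma> * (1 + 2 powr \<sigma>) * (2 powr \<sigma> * (C + 4 powr \<sigma> * C * V / v))"
  have K: "0 < K" unfolding K_def using C V v by (intro mult_pos_pos add_pos_pos divide_pos_pos) auto
  define C0 where "C0 = K * M * (2 + 2 / R0) powr \<sigma>"
  have "0 < 2 + 2 / R0" using R0 by (intro add_pos_pos divide_pos_pos) auto
  then have C0: "0 < C0" unfolding C0_def using K M by simp
  have "oscillation_integral \<mu> \<sigma> u x R \<le>
      ennreal (C0 * R powr (\<sigma> + b) * exp (\<kappa> * R)) * gradient_integral \<mu> \<sigma> g x (2 * \<Lambda> * R)"
    if u: "continuous_on UNIV u" and g: "upper_gradient u g" and R: "R0 \<le> R" for u :: "'a \<Rightarrow> real" and g R x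
  proof (cases "gradient_integral \<mu> \<sigma> g x (2 * \<Lambda> * R)")
    case top
    \<comment> \<open>In \<open>ennreal\<close> the product of 0 and infinity is 0, so the constant
      has to be nonzero for the right side to be infinite.\<close>
    have "ennreal (C0 * R powr (\<sigma> + b) * exp (\<kappa> * R)) \<noteq> 0" using C0 R R0 by simp
    then show ?thesis using top by (simp only: ennreal_mult_top) simp
  next
    case (real A)
    have loc1: "oscillation_integral \<mu> \<sigma> u z r \<le> ennreal C * gradient_integral \<mu> \<sigma> g z r"
      if "0 < r" "r \<le> 1" for z r
      using locC u g that r0 by auto
    \<comment> \<open>Enough half steps to reach distance R + 1/2, within which the centres of the
      relevant covering balls lie.\<close>
    define n where "n = nat \<lceil>2 * R + 1\<rceil>"
    have n: "2 * R + 1 \<le> real n" "real n \<le> 2 * R + 2"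
      using R R0 unfolding n_def by linarith+
    have "2 / R0 * R0 \<le> 2 / R0 * R" using R R0 by (intro mult_left_mono) auto
    then have "R + 2 \<le> (1 + 2 / R0) * R" using R0 by (simp add: algebra_simps)
    also have "\<dots> \<le> \<Lambda> * R" using \<Lambda> R R0 by (intro mult_right_mono) auto
    finally have "real n / 2 + 1 \<le> 2 * \<Lambda> * R" using n R R0 by linarith
    then have "gradient_integral \<mu> \<sigma> g x (real n / 2 + 1) \<le> ennreal A"
      using gradient_integral_mono[OF subset_ball] real(2) by metis
    then have osc: "oscillation_integral \<mu> \<sigma> u x R \<le> ennreal (K * real (N R) * real n powr \<sigma> * A)"
      unfolding K_def using \<sigma> C v V cover[OF R] R R0 n real(1) loc1 u
      by (intro poincare_from_cover) auto
    have "2 \<le> 2 / R0 * R" using R R0 by (simp add: pos_le_divide_eq)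
    then have "real n powr \<sigma> \<le> ((2 + 2 / R0) * R) powr \<sigma>"
      using n \<sigma> by (intro powr_mono2) (auto simp: algebra_simps)
    also have "\<dots> = (2 + 2 / R0) powr \<sigma> * R powr \<sigma>"
      using R R0 by (simp add: powr_mult)
    finally have "real (N R) * real n powr \<sigma> \<le> (M * R powr b * exp (\<kappa> * R)) * ((2 + 2 / R0) powr \<sigma> * R powr \<sigma>)"
      using growth[OF R] by (intro mult_mono) auto
    then have "K * (real (N R) * real n powr \<sigma>) * A
        \<le> K * ((M * R powr b * exp (\<kappa> * R)) * ((2 + 2 / R0) powr \<sigma> * R powr \<sigma>)) * A"
      using K real(1) by (intro mult_right_mono mult_left_mono) auto
    also have "\<dots> = (C0 * R powr (\<sigma> + b) * exp (\<kappa> * R)) * A"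
      by (simp add: C0_def powr_add)
    finally have "oscillation_integral \<mu> \<sigma> u x R \<le> ennreal ((C0 * R powr (\<sigma> + b) * exp (\<kappa> * R)) * A)"
      by (intro order_trans[OF osc ennreal_leI]) (simp add: mult.assoc)
    also have "\<dots> = ennreal (C0 * R powr (\<sigma> + b) * exp (\<kappa> * R)) * gradient_integral \<mu> \<sigma> g x (2 * \<Lambda> * R)"
      using real C0 by (simp add: ennreal_mult')
    finally show ?thesis .
  qed
  then show ?thesis using C0 by blast
qed

lemma exponential_growth_cover:
  assumes "0 < R0" "0 \<le> b"
  shows "\<exists>N M \<kappa>. 0 < M \<and> 0 \<le> \<kappa> \<and> (\<forall>(x::'a) R. R0 \<le> R \<longrightarrow> covered_by (ball x R) (N R)) \<and>
    (\<forall>R\<ge>R0. real (N R) \<le> M * R powr b * exp (\<kappa> * R))"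
proof -
  obtain M :: nat where M: "1 \<le> M" "\<And>(x::'a) k. covered_by (cball x (real k / 4)) (M ^ Suc k)"
    using exponential_cover by blast
  define N where "N = (\<lambda>R::real. M ^ Suc (nat \<lceil>4 * R\<rceil>))"
  have "covered_by (ball x R) (N R)" for x :: 'a and R
    unfolding N_def
  proof (rule covered_by_mono[OF M(2)[of x]])
    have "R \<le> real (nat \<lceil>4 * R\<rceil>) / 4" by linarith
    then show "ball x R \<subseteq> cball x (real (nat \<lceil>4 * R\<rceil>) / 4)" by auto
  qed simp
  moreover have "real (N R) \<le> (real M powr 2 * R0 powr - b) * R powr b * exp ((4 * ln (real M)) * R)"
    if "R0 \<le> R" for R
  proof -
    have "real (N R) = real M powr real (Suc (nat \<lceil>4 * R\<rceil>))"
      unfolding N_def using M(1) by (subst powr_realpow) auto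
    \<comment> \<open>The ceiling and the successor each add at most 1 to the exponent.\<close>
    also have "\<dots> \<le> real M powr (2 + 4 * R)"
      using M(1) that assms by (intro powr_mono) linarith+
    also have "\<dots> = real M powr 2 * exp ((4 * ln (real M)) * R) * 1"
      using M(1) by (simp add: powr_add) (simp add: powr_def mult_ac)
    also have "\<dots> \<le> real M powr 2 * exp ((4 * ln (real M)) * R) * (R0 powr - b * R powr b)"
      using powr_le_powr_add[OF assms(1) that assms(2), of 0] that assms(1) by (intro mult_left_mono) auto
    finally show ?thesis by (simp add: mult_ac)
  qed
  moreover have "0 < real M powr 2 * R0 powr - b" "0 \<le> 4 * ln (real M)"
    using M(1) assms(1) by auto
  ultimately show ?thesis by blast
qed

text \<open>Entropy at most zero rules out tripods with arms \<open>L\<close>, which gives near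
  alignment with constant \<delta> + L and so a linear count. The condition 1 \<le> b makes room for
  it in R powr b.\<close>

lemma linear_growth_cover:
  assumes "gromov_hyperbolic_space TYPE('a) \<delta>" "volume_entropy \<mu> x0 \<le> 0" "0 < R0" "1 \<le> b"
  shows "\<exists>N M. 0 < M \<and> (\<forall>(x::'a) R. R0 \<le> R \<longrightarrow> covered_by (ball x R) (N R)) \<and>
    (\<forall>R\<ge>R0. real (N R) \<le> M * R powr b)"
proof -
  define L where "L = 14 * \<delta> + 3 * E + 1"
  have \<delta>: "0 \<le> \<delta>" using assms(1) by (simp add: gromov_hyperbolic_space_def)
  have "\<not> has_tripod TYPE('a) \<delta> L"
    using tripod_imp_entropy_pos[OF assms(1), of x0] assms(2) unfolding L_def by (auto simp: not_less[symmetric])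
  note aligned = aligned_if_no_tripod[OF assms(1) this]
  have "0 \<le> \<delta> + L" using \<delta> E_pos by (simp add: L_def)
  then obtain M :: nat where M: "1 \<le> M" "\<And>(x::'a) n. covered_by (cball x (real n)) (M * Suc n)"
    using linear_cover[OF aligned] by blast
  define N where "N = (\<lambda>R::real. M * Suc (nat \<lceil>R\<rceil>))"
  have "covered_by (ball x R) (N R)" for x :: 'a and R
    unfolding N_def
  proof (rule covered_by_mono[OF M(2)[of x]])
    have "R \<le> real (nat \<lceil>R\<rceil>)" by linarith
    then show "ball x R \<subseteq> cball x (real (nat \<lceil>R\<rceil>))" by auto
  qed simp
  moreover have "real (N R) \<le> (real M * (1 + 2 / R0) * R0 powr - (b - 1)) * R powr b" if "R0 \<le> R" for R
  proof -
    have "2 \<le> 2 / R0 * R" using that assms(3) by (simp add: pos_le_divide_eq)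
    moreover have "real (Suc (nat \<lceil>R\<rceil>)) \<le> R + 2" using that assms(3) by linarith
    ultimately have "real (Suc (nat \<lceil>R\<rceil>)) \<le> (1 + 2 / R0) * R powr 1"
      using that assms(3) by (simp add: algebra_simps)
    also have "\<dots> \<le> (1 + 2 / R0) * (R0 powr - (b - 1) * R powr (1 + (b - 1)))"
      using that assms by (intro mult_left_mono powr_le_powr_add) auto
    finally have "real M * real (Suc (nat \<lceil>R\<rceil>))
        \<le> real M * ((1 + 2 / R0) * (R0 powr - (b - 1) * R powr (1 + (b - 1))))"
      by (intro mult_left_mono) auto
    then show ?thesis by (simp add: N_def algebra_simps)
  qed
  moreover have "0 < real M * (1 + 2 / R0) * R0 powr - (b - 1)"
    using M(1) assms(3) by (intro mult_pos_pos add_pos_pos) auto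
  ultimately show ?thesis by blast
qed

end

section \<open>Cobounded actions\<close>

text \<open>The margin between D and e lets a group element be chosen without asking whether the
  infimum of the distances is attained.\<close>

lemma orbit_near:
  assumes "isometric_action G \<phi>" "quotient_diameter G \<phi> \<le> ereal D" "D < e"
  shows "\<exists>g\<in>carrier G. dist x (\<phi> g y) < e"
proof -
  interpret group_action G UNIV \<phi>
    using assms(1) by (simp add: isometric_action_def)
  interpret group_hom G "BijGroup UNIV" \<phi> by (rule group_hom)
  have "ereal (quotient_dist G \<phi> x y) \<le> quotient_diameter G \<phi>"
    unfolding quotient_diameter_def by (intro SUP_upper2[where i = x] SUP_upper2[where i = y]) auto
  then have "quotient_dist G \<phi> x y < e"
    using assms(2,3) by (metis ereal_less_eq(3) order_trans order_le_less_trans)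
  moreover have "carrier G \<noteq> {}" using one_closed by blast
  moreover have "bdd_below ((\<lambda>g. dist x (\<phi> g y)) ` carrier G)"
    by (intro bdd_belowI2[where m = 0]) simp
  ultimately show ?thesis
    unfolding quotient_dist_def by (simp add: cINF_less_iff)
qed

lemma homogeneous_within_if_cobounded:
  assumes "isometric_action G \<phi>" "quotient_diameter G \<phi> \<le> ereal D" "measure_preserving_action G \<phi> \<mu>" "D < e"
  shows "homogeneous_within \<mu> e"
  unfolding homogeneous_within_def
proof (intro allI)
  fix x y
  obtain g where g: "g \<in> carrier G" "dist y (\<phi> g x) < e"
    using orbit_near[OF assms(1,2,4)] by blast
  interpret group_action G UNIV \<phi>
    using assms(1) by (simp add: isometric_action_def)
  have "measured_isometry \<mu> (\<phi> g)"
    using g(1) assms(1,3) surj_prop[OF g(1)]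
    by (auto simp: measured_isometry_def isometric_action_def measure_preserving_action_def)
  then show "\<exists>f. measured_isometry \<mu> f \<and> dist (f x) y \<le> e"
    using g(2) by (intro exI[of _ "\<phi> g"]) (auto simp: dist_commute)
qed

text \<open>For \<open>D = 0\<close> the (closed, locally finite) orbits are dense, so a small ball is finite, which is
  impossible on a nontrivial geodesic.\<close>

lemma singleton_if_dense_orbits:
  fixes x y :: "'a::metric_space"
  assumes geo: "proper_geodesic_space TYPE('a)" and act: "isometric_action G (\<phi> :: 'g \<Rightarrow> 'a \<Rightarrow> 'a)"
    and proper: "proper_action G \<phi>" and diam: "quotient_diameter G \<phi> \<le> ereal 0"
  shows "x = y"
proof (rule ccontr)
  assume "x \<noteq> y"
  obtain c L where c: "geodesic_path c L x y"
    using geo unfolding proper_geodesic_space_def geodesic_segment_def by blast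
  have L: "0 < L" "c 0 = x" using \<open>x \<noteq> y\<close> geodesic_path_imp_dist[OF c] c
    by (auto simp: geodesic_path_def)
  have "compact (cball x 1)" using geo by (simp add: proper_geodesic_space_def)
  then have fin: "finite {g \<in> carrier G. \<phi> g ` cball x 1 \<inter> cball x 1 \<noteq> {}}"
    using proper unfolding proper_action_def by blast
  define F where "F = (\<lambda>g. \<phi> g x) ` {g \<in> carrier G. \<phi> g ` cball x 1 \<inter> cball x 1 \<noteq> {}}"
  have F: "finite F" unfolding F_def using fin by simp
  \<comment> \<open>\<open>F\<close> is finite by properness and contains every orbit point of x in
    \<open>cball x 1\<close>. Being finite it is closed, so density leaves no other points in the
    small ball.\<close>
  have "ball x (1/2) \<subseteq> closure F"
  proof
    fix z assume z: "z \<in> ball x (1/2)"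
    show "z \<in> closure F"
      unfolding closure_approachable
    proof (intro allI impI)
      fix e :: real assume "0 < e"
      then obtain g where g: "g \<in> carrier G" "dist z (\<phi> g x) < min e (1/2)"
        using orbit_near[OF act diam, of "min e (1/2)" z x] by auto
      then have "dist x (\<phi> g x) \<le> 1" using z dist_triangle[of x "\<phi> g x" z] by simp
      then have "\<phi> g x \<in> \<phi> g ` cball x 1 \<inter> cball x 1" by simp
      then have "\<phi> g x \<in> F" using g(1) unfolding F_def by blast
      then show "\<exists>y\<in>F. dist y z < e" using g(2) by (intro bexI) (auto simp: dist_commute)
    qed
  qed
  then have "finite (ball x (1/2))"
    using F by (simp add: finite_imp_closed finite_subset)
  moreover have "c ` {0..<min L (1/2)} \<subseteq> ball x (1/2)"
    using c L by (auto simp: geodesic_path_def)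
  ultimately have "finite (c ` {0..<min L (1/2)})" by (rule finite_subset[rotated])
  moreover have "inj_on c {0..<min L (1/2)}"
  proof (rule inj_onI)
    fix s t assume st: "s \<in> {0..<min L (1/2)}" "t \<in> {0..<min L (1/2)}" "c s = c t"
    then have "s \<in> {0..L}" "t \<in> {0..L}" by auto
    then have "dist (c s) (c t) = \<bar>s - t\<bar>"
      using c unfolding geodesic_path_def by blast
    then show "s = t" using st(3) by simp
  qed
  ultimately have "finite {0..<min L (1/2)}" by (rule finite_imageD)
  moreover have "infinite {0..<min L (1/2)}" using L(1) by (intro infinite_Ico) simp
  ultimately show False by blast
qed

theorem theorem1p2:
  fixes \<mu> :: "'a::metric_space measure"
    and \<Gamma> :: "('g, 'b) monoid_scheme"
    and \<phi> :: "'g \<Rightarrow> 'a \<Rightarrow> 'a"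
    and \<delta> \<sigma> r0 D H :: real
    and x0 :: 'a
  assumes "measured_metric_space \<mu>"
    and "gromov_hyperbolic_space TYPE('a) \<delta>"
    and "\<sigma> \<ge> 1"
    and "r0 \<ge> 1"
    and "local_poincare \<mu> \<sigma> r0"
    and "isometric_action \<Gamma> \<phi>"
    and "proper_action \<Gamma> \<phi>"
    and "quotient_diameter \<Gamma> \<phi> \<le> ereal D"
    and "measure_preserving_action \<Gamma> \<phi> \<mu>"
    and "volume_entropy \<mu> x0 \<le> ereal H"
  shows "\<exists>C0 \<Lambda>::real. C0 > 0 \<and> \<Lambda> \<ge> 1 \<and>
    (\<forall>(u::'a \<Rightarrow> real) g. continuous_on UNIV u \<longrightarrow> upper_gradient u g \<longrightarrow>
      (\<forall>R x. R \<ge> 5 / 2 * (7 * D + 4 * \<delta>) \<longrightarrow>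
        oscillation_integral \<mu> \<sigma> u x R \<le>
          ennreal (C0 * R powr (\<sigma> + 6 * H * D + 21 / 4) * exp (12 * \<Lambda> * H * R)) *
          gradient_integral \<mu> \<sigma> g x (2 * \<Lambda> * R)))"
proof -
  \<comment> \<open>The sign of D comes from the diameter bound: every e > D strictly exceeds some
    distance and is therefore positive.\<close>
  have "\<exists>g\<in>carrier \<Gamma>. dist x0 (\<phi> g x0) < e" if "D < e" for e
    using orbit_near[OF assms(6,8) that] by blast
  then have "0 < e" if "D < e" for e
    using that by (meson le_less_trans zero_le_dist)
  then have D: "0 \<le> D" by (meson dense_ge less_imp_le)
  interpret homogeneous_measured_space \<mu> "D + 1"
    using assms(1) D homogeneous_within_if_cobounded[OF assms(6,8,9), of "D + 1"]
    by unfold_locales auto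
  have H: "0 \<le> H"
    using order_trans[OF volume_entropy_nonneg assms(10)] by simp
  have \<delta>: "0 \<le> \<delta>" using assms(2) by (simp add: gromov_hyperbolic_space_def)
  define R0 where "R0 = 5 / 2 * (7 * D + 4 * \<delta>)"
  \<comment> \<open>What the exponent of R leaves for the covering numbers once \<sigma> is spent on
    the length of the chains.\<close>
  define b where "b = 6 * H * D + 21 / 4"
  have b: "1 \<le> b" "\<sigma> + b = \<sigma> + 6 * H * D + 21 / 4" using mult_nonneg_nonneg[OF H D] by (auto simp: b_def)
  show ?thesis
  proof (cases "R0 = 0")
    case True
    then have "D = 0" using D \<delta> by (simp add: R0_def)
    then have single: "y = x" for x y :: 'a
      using singleton_if_dense_orbits[OF proper_geodesic assms(6,7)] assms(8) by simp
    have "oscillation_integral \<mu> \<sigma> u x R = 0" for u :: "'a \<Rightarrow> real" and x R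
    proof (cases "0 < R")
      case True
      have "u = (\<lambda>_. u x)" using single by metis
      then have "(LINT y:ball x R|\<mu>. u y) = measure \<mu> (ball x R) * u x"
        by (metis set_integral_const_ball)
      then have "ball_mean \<mu> u x R = u x"
        using measure_ball_pos[OF True, of x] by (simp add: ball_mean_def)
      then have "\<bar>u y - ball_mean \<mu> u x R\<bar> = 0" for y using single[of y x] by simp
      then show ?thesis by (simp add: oscillation_integral_def)
    next
      case False
      then have "ball x R = {}" by simp
      then show ?thesis by (simp only: oscillation_integral_def) simp
    qed
    then show ?thesis by (intro exI[of _ 1]) simp
  next
    case False
    then have R0: "0 < R0" using D \<delta> by (simp add: R0_def)
    have "\<exists>N M \<Lambda>. 0 < M \<and> 1 + 2 / R0 \<le> \<Lambda> \<and> (\<forall>(x::'a) R. R0 \<le> R \<longrightarrow> covered_by (ball x R) (N R)) \<and>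
      (\<forall>R\<ge>R0. real (N R) \<le> M * R powr b * exp (12 * \<Lambda> * H * R))"
    proof (cases "H = 0")
      case True
      then have "volume_entropy \<mu> x0 \<le> 0" using assms(10) by (simp add: zero_ereal_def)
      then obtain N M where "0 < M" "\<forall>(x::'a) R. R0 \<le> R \<longrightarrow> covered_by (ball x R) (N R)"
        "\<forall>R\<ge>R0. real (N R) \<le> M * R powr b"
        using linear_growth_cover[OF assms(2) _ R0 b(1)] by blast
      then show ?thesis
        using True by (intro exI[of _ N] exI[of _ M] exI[of _ "1 + 2 / R0"]) simp
    next
      case False
      then have "0 < H" using H by simp
      obtain N M \<kappa> where NM: "0 < M" "0 \<le> \<kappa>" "\<forall>(x::'a) R. R0 \<le> R \<longrightarrow> covered_by (ball x R) (N R)"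
        "\<forall>R\<ge>R0. real (N R) \<le> M * R powr b * exp (\<kappa> * R)"
        using exponential_growth_cover[OF R0, of b] b(1) by auto
      \<comment> \<open>The first bound makes room for the gradient ball, the second keeps the rate
        \<kappa> below 12 * \<Lambda> * H.\<close>
      define \<Lambda> where "\<Lambda> = max (1 + 2 / R0) (\<kappa> / (12 * H))"
      have "\<kappa> / (12 * H) * (12 * H) \<le> \<Lambda> * (12 * H)"
        unfolding \<Lambda>_def using H by (intro mult_right_mono) auto
      then have \<kappa>: "\<kappa> \<le> 12 * \<Lambda> * H" using \<open>0 < H\<close> by simp
      have "real (N R) \<le> M * R powr b * exp (12 * \<Lambda> * H * R)" if "R0 \<le> R" for R
      proof -
        have "\<kappa> * R \<le> 12 * \<Lambda> * H * R"
          using \<kappa> that R0 by (intro mult_right_mono) auto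
        then have "M * R powr b * exp (\<kappa> * R) \<le> M * R powr b * exp (12 * \<Lambda> * H * R)"
          using NM(1) by (intro mult_left_mono) auto
        then show ?thesis using NM(4) that by (meson order_trans)
      qed
      then show ?thesis
        using NM by (intro exI[of _ N] exI[of _ M] exI[of _ \<Lambda>]) (simp add: \<Lambda>_def)
    qed
    then obtain N M \<Lambda> where NM: "0 < M" "1 + 2 / R0 \<le> \<Lambda>"
      "\<And>(x::'a) R. R0 \<le> R \<Longrightarrow> covered_by (ball x R) (N R)"
      "\<And>R. R0 \<le> R \<Longrightarrow> real (N R) \<le> M * R powr b * exp (12 * \<Lambda> * H * R)"
      by blast
    have "0 < 2 / R0" using R0 by simp
    then have "1 \<le> \<Lambda>" using NM(2) by linarith
    then show ?thesis
      using poincare_from_growth[OF assms(3,4,5) R0 NM(1,2), of N b "12 * \<Lambda> * H"] NM(3,4)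
      unfolding b(2) R0_def[symmetric] by blast
  qed
qed

end
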